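(* Let $\lambda,\mu\in\mathring P^-$ be anti-dominant weights. Then $$\Big\langle \frac{\chi_\lambda}{S(q)},P_\mu(q)\Big\rangle_q=\langle P_\mu(q),\chi_\lambda\rangle .$$
   Context: **Affine data.** $\mathfrak g$ is an arbitrary indecomposable affine Lie algebra with affine Cartan matrix $A=(a_{ij})_{0\le i,j\le n}$; nodes are numbered, and labels $a_0,\dots,a_n$ taken, as in Kac's Tables Aff ( *Infinite dimensional Lie algebras* ), so $a_0=2$ for type $A_{2n}^{(2)}$ and $a_0=1$ otherwise. $R$ is the root system, $\alpha_0,\dots,\alpha_n$ the simple roots, $R^{re,+}$ the positive real roots, $\delta=\sum_i a_i\alpha_i$. $\mathring{\mathfrak g}\subset\mathfrak g$ is the finite-dimensional simple Lie algebra with Cartan matrix $(a_{ij})_{1\le i,j\le n}$, with Cartan subalgebra $\mathring{\mathfrak h}$, roots $\mathring R=\mathring R^+\cup\mathring R^-$, Weyl group $\mathring W$ with longest element $w_\circ$, weight lattice $\mathring P$, dominant weights $\mathring P^+$, anti-dominant weights $\mathring P^-$. $\bar Q\subset\mathring{\mathfrak h}^*$ is the lattice spanned by the restrictions $\alpha|_{\mathring{\mathfrak h}}$, $\alpha\in R$; $\bar Q^+$ is the intersection of $\bar Q$ with the cone spanned by $\mathring R^+$. Order: $\mu\le\lambda$ iff $\lambda-\mu\in\bar Q^+$. For $\lambda\in\mathring P^-$, $\chi_\lambda$ is the character of the irreducible $\mathring{\mathfrak g}$-module of highest weight $w_\circ(\lambda)$. **Macdonald polynomials (all $t$-parameters equal;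 for $A_{2n}^{(2)}$ specialized Koornwinder polynomials).** Convention $e^\delta:=q^{-1}$, i.e. $e^{\mu+s\delta}=q^{-s}e^\mu$. $\mathbb F_{q,t}=\mathbb Q(q^{a_0^{-1}},t)$, $\mathcal R_{q,t}=\mathbb F_{q,t}[e^\lambda;\lambda\in\mathring P]$, $\mathcal R_q=\mathbb Q(q^{a_0^{-1}})[e^\lambda;\lambda\in\mathring P]$, with $\mathring W$ acting through $\mathring P$. The involution $\overline{\,\cdot\,}$ of $\mathcal R_{q,t}$ inverts $q$ and $t$ and sends $e^\lambda\mapsto e^{-\lambda}$; the involution $\iota$, $f\mapsto f^\iota$, fixes $q,t$ and sends $e^\lambda\mapsto e^{-w_\circ(\lambda)}$. $[f]$ denotes the coefficient of $e^0$. Let $$\nabla(q,t)=\prod_{\alpha\in\mathring R^-\cup R^{re,+}}\frac{1-e^\alpha}{1-t^{-1}e^\alpha},$$ expanded as a formal series in the $e^\lambda$ with coefficients power series in $t^{-1}$ and $q^{-a_0^{-1}}$, and $\Delta(q,t)=\nabla(q,t)/[\nabla(q,t)]$, whose coefficients lie in $\mathbb F_{q,t}$. For $f,g\in\mathcal R_{q,t}^{\mathring W}$ put $\langle f,g\rangle_{q,t}=[f\bar g\Delta(q,t)]$. With $m_\lambda=\sum_{\mu\in\mathring W(\lambda)}e^\mu$ for $\lambda\in\mathring P^+$, the polynomials $\{P_\lambda(q,t)\}_{\lambda\in\mathring P^-}\subset\mathcal R_{q,t}^{\mathring W}$ are uniquely determined by: (a) $P_\lambda-m_{w_\circ(\lambda)}\in\bigoplus_{\mu\in\mathring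 P^+,\,\mu<w_\circ(\lambda)}\mathbb F_{q,t}m_\mu$; (b) $\langle P_\lambda,P_\mu\rangle_{q,t}=0$ for $\lambda\ne\mu$. $P_\lambda(q):=\lim_{t\to\infty}P_\lambda(q,t)$ (coefficientwise; the limit is known to exist). **Limit scalar products and $S(q)$.** $\nabla(q,\infty)=\prod_{\alpha\in\mathring R^-\cup R^{re,+}}(1-e^\alpha)$, $\Delta(q,\infty)=\nabla(q,\infty)/[\nabla(q,\infty)]$, and $\Delta(\infty,\infty)=\frac1{|\mathring W|}\prod_{\alpha\in\mathring R}(1-e^\alpha)$ (the limit as $q\to\infty$). Define $$\langle f,g\rangle_q=[fg^\iota\Delta(q,\infty)],\qquad \langle f,g\rangle=[fg^\iota\Delta(\infty,\infty)],\qquad S(q)=\frac{\Delta(q,\infty)}{\Delta(\infty,\infty)},$$ so $S(q)=\frac{|\mathring W|}{[\nabla(q,\infty)]}\prod_{\alpha\in R^{re,+}\setminus\mathring R^+}(1-e^\alpha)$, an invertible power series in $q^{-a_0^{-1}}$ with coefficients in $\mathbb Q[e^\mu;\mu\in\mathring P]^{\mathring W}$. The scalar products, defined on $\mathcal R_q^{\mathring W}$, are extended by the same formulas to formal Laurent series in $q^{-a_0^{-1}}$ with coefficients in $\mathbb Q[e^\mu;\mu\in\mathring P]^{\mathring W}$ (rational functions of $q^{a_0^{-1}}$ being expanded as Laurent series in $q^{-a_0^{-1}}$); $\chi_\lambda/S(q)$ is such a series. *)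

theory Defs
  imports
    "HOL-Library.Poly_Mapping"
    "HOL-Computational_Algebra.Polynomial"
    "HOL-Computational_Algebra.Fraction_Field"
    "HOL-Computational_Algebra.Formal_Power_Series"
    "HOL-Computational_Algebra.Formal_Laurent_Series"
begin

section \<open>Algebraic preliminaries\<close>

text \<open>
  Weights are recorded by their values on the simple coroots \<open>1, \<dots>, n\<close> and elements of the root
  lattice by their coefficients on the simple roots \<open>0, \<dots>, n\<close>. The group ring \<open>k[e\<^sup>\<lambda>]\<close> is
  \<open>weight \<Rightarrow>\<^sub>0 'k\<close>, with \<open>e\<^sup>\<lambda>\<close> written \<open>Poly_Mapping.single \<lambda> 1\<close>.
\<close>

type_synonym weight = "nat \<Rightarrow>\<^sub>0 int"
type_synonym root = "nat \<Rightarrow>\<^sub>0 int"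
type_synonym 'k group_ring = "weight \<Rightarrow>\<^sub>0 'k"

text \<open>
  Rational functions. The variable of the inner field is \<open>q\<close> to the power \<open>1/a\<^sub>0\<close>, the variable
  of the outer one is \<open>t\<close>.
\<close>

type_synonym Fq = "rat poly fract"
type_synonym Fqt = "Fq poly fract"

definition ratvar :: "'a::idom poly fract" where
  "ratvar = Fraction_Field.Fract [:0, 1:] 1"

text \<open>Substitute \<open>b\<close> for the variable of a rational function and apply \<open>\<phi>\<close> to its coefficients.\<close>

definition eval_ratfun :: "('a::idom \<Rightarrow> 'b::field) \<Rightarrow> 'b \<Rightarrow> 'a poly fract \<Rightarrow> 'b" where
  "eval_ratfun \<phi> b f = (THE c. \<exists>p r. r \<noteq> 0 \<and> f = Fraction_Field.Fract p r \<and>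
     poly (map_poly \<phi> r) b \<noteq> 0 \<and> c = poly (map_poly \<phi> p) b / poly (map_poly \<phi> r) b)"

text \<open>\<open>f\<close>, a rational function of one variable, has the finite limit \<open>c\<close> at infinity.\<close>

definition ratfun_lim_infinity :: "'a::field poly fract \<Rightarrow> 'a \<Rightarrow> bool" where
  "ratfun_lim_infinity f c \<longleftrightarrow> (\<exists>p r. r \<noteq> 0 \<and> f = Fraction_Field.Fract p r \<and>
     Polynomial.degree p \<le> Polynomial.degree r \<and>
     c = Polynomial.coeff p (Polynomial.degree r) / lead_coeff r)"

text \<open>The quotient of \<open>f\<close> by \<open>g \<noteq> 0\<close> in a domain, meant for the case that \<open>g\<close> divides \<open>f\<close>.\<close>

definition exact_quot :: "'a::idom \<Rightarrow> 'a \<Rightarrow> 'a" where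
  "exact_quot f g = (THE h. h * g = f)"

text \<open>
  Infinite products of power series, as limits of the finite subproducts in the \<open>X\<close>-adic topology
  of \<^typ>\<open>'a fps\<close>.
\<close>

definition formal_prod :: "'i set \<Rightarrow> ('i \<Rightarrow> 'a::comm_ring_1 fps) \<Rightarrow> 'a fps" where
  "formal_prod I f = Lim (finite_subsets_at_top I) (\<lambda>T. \<Prod>i\<in>T. f i)"

definition fls_map :: "('a::zero \<Rightarrow> 'b::zero) \<Rightarrow> 'a fls \<Rightarrow> 'b fls" where
  "fls_map h f = Abs_fls (\<lambda>k. h (fls_nth f k))"


section \<open>Affine Cartan matrices\<close>

text \<open>
  Indecomposable generalized Cartan matrices \<open>(A i j)\<close> with \<open>0 \<le> i, j \<le> n\<close> of affine type, as in
  Kac, Theorem 4.3 (Aff); the entries with other indices play no role.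
\<close>

definition mat_app :: "nat \<Rightarrow> (nat \<Rightarrow> nat \<Rightarrow> int) \<Rightarrow> (nat \<Rightarrow> real) \<Rightarrow> nat \<Rightarrow> real" where
  "mat_app n A v i = (\<Sum>j\<le>n. real_of_int (A i j) * v j)"

definition affine_cartan_matrix :: "nat \<Rightarrow> (nat \<Rightarrow> nat \<Rightarrow> int) \<Rightarrow> bool" where
  "affine_cartan_matrix n A \<longleftrightarrow>
     (\<forall>i\<le>n. A i i = 2) \<and>
     (\<forall>i\<le>n. \<forall>j\<le>n. i \<noteq> j \<longrightarrow> A i j \<le> 0) \<and>
     (\<forall>i\<le>n. \<forall>j\<le>n. A i j = 0 \<longrightarrow> A j i = 0) \<and>
     (\<forall>J. J \<noteq> {} \<and> J \<subset> {..n} \<longrightarrow> (\<exists>i\<in>J. \<exists>j\<in>{..n} - J. A i j \<noteq> 0)) \<and>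
     (\<exists>u. (\<forall>i\<le>n. u i > 0) \<and> (\<forall>i\<le>n. mat_app n A u i = 0) \<and>
        (\<forall>v. (\<forall>i\<le>n. mat_app n A v i = 0) \<longrightarrow> (\<exists>c. \<forall>i\<le>n. v i = c * u i))) \<and>
     (\<forall>v. (\<forall>i\<le>n. mat_app n A v i \<ge> 0) \<longrightarrow> (\<forall>i\<le>n. mat_app n A v i = 0))"

text \<open>The labels \<open>a\<^sub>0, \<dots>, a\<^sub>n\<close>.\<close>

definition label :: "nat \<Rightarrow> (nat \<Rightarrow> nat \<Rightarrow> int) \<Rightarrow> nat \<Rightarrow> nat" where
  "label n A = (THE a. (\<forall>i\<le>n. a i > 0) \<and> (\<forall>i>n. a i = 0) \<and> Gcd (a ` {..n}) = 1 \<and>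
     (\<forall>i\<le>n. (\<Sum>j\<le>n. A i j * int (a j)) = 0))"

text \<open>Type \<open>A\<^sub>2\<^sub>n\<^sup>(\<^sup>2\<^sup>)\<close> (\<open>n \<ge> 1\<close>), with Kac's numbering of the nodes, so that \<open>a\<^sub>0 = 2\<close>.\<close>

definition cartan_A2n_twisted :: "nat \<Rightarrow> nat \<Rightarrow> nat \<Rightarrow> int" where
  "cartan_A2n_twisted n i j =
     (if i = j then 2
      else if n = 1 then (if i = 0 then - 4 else - 1)
      else if j = i + 1 then (if i = 0 \<or> j = n then - 2 else - 1)
      else if i = j + 1 then - 1
      else 0)"

text \<open>
  Kac's numbering. The labels \<open>a\<^sub>0\<^sup>\<or>, \<dots>, a\<^sub>n\<^sup>\<or>\<close> are those of the transposed matrix. Outside type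
  \<open>A\<^sub>2\<^sub>n\<^sup>(\<^sup>2\<^sup>)\<close> the nodes \<open>i\<close> with \<open>a\<^sub>i = a\<^sub>i\<^sup>\<or> = 1\<close> form one orbit under diagram automorphisms, and
  the node \<open>0\<close> of the Tables Aff belongs to it; type \<open>A\<^sub>2\<^sub>n\<^sup>(\<^sup>2\<^sup>)\<close> has no such node. The order of the
  nodes \<open>1, \<dots>, n\<close> does not affect any of the notions below.
\<close>

definition kac_numbered :: "nat \<Rightarrow> (nat \<Rightarrow> nat \<Rightarrow> int) \<Rightarrow> bool" where
  "kac_numbered n A \<longleftrightarrow>
     (label n A 0 = 1 \<and> label n (\<lambda>i j. A j i) 0 = 1) \<or>
     (\<forall>i\<le>n. \<forall>j\<le>n. A i j = cartan_A2n_twisted n i j)"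

definition affine_datum :: "nat \<Rightarrow> (nat \<Rightarrow> nat \<Rightarrow> int) \<Rightarrow> bool" where
  "affine_datum n A \<longleftrightarrow> affine_cartan_matrix n A \<and> kac_numbered n A"


section \<open>Weyl groups, roots and weights\<close>

text \<open>The composite \<open>s i\<^sub>1 \<circ> \<dots> \<circ> s i\<^sub>k\<close> for a word \<open>i\<^sub>1 \<dots> i\<^sub>k\<close>.\<close>

definition refl_word :: "(nat \<Rightarrow> 'a \<Rightarrow> 'a) \<Rightarrow> nat list \<Rightarrow> 'a \<Rightarrow> 'a" where
  "refl_word s is = foldr (\<lambda>i w. s i \<circ> w) is id"

context
  fixes n :: nat and A :: "nat \<Rightarrow> nat \<Rightarrow> int"
begin

definition root_refl :: "nat \<Rightarrow> root \<Rightarrow> root" where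
  "root_refl i \<alpha> = \<alpha> - Poly_Mapping.single i (\<Sum>j\<le>n. A i j * Poly_Mapping.lookup \<alpha> j)"

definition real_roots :: "root set" where
  "real_roots = {refl_word root_refl is (Poly_Mapping.single i 1) | is i. set is \<subseteq> {..n} \<and> i \<le> n}"

definition imaginary_roots :: "root set" where
  "imaginary_roots = {\<Sum>i\<le>n. Poly_Mapping.single i (k * int (label n A i)) | k. k \<noteq> 0}"

definition affine_roots :: "root set" where
  "affine_roots = real_roots \<union> imaginary_roots"

definition pos_real_roots :: "root set" where
  "pos_real_roots = {\<alpha> \<in> real_roots. \<forall>i. Poly_Mapping.lookup \<alpha> i \<ge> 0}"

text \<open>The roots of the finite-dimensional subalgebra, inside the affine root lattice.\<close>

definition fin_roots :: "root set" where
  "fin_roots =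
     {refl_word root_refl is (Poly_Mapping.single i 1) | is i. set is \<subseteq> {1..n} \<and> i \<in> {1..n}}"

definition fin_pos_roots :: "root set" where
  "fin_pos_roots = {\<alpha> \<in> fin_roots. \<forall>i. Poly_Mapping.lookup \<alpha> i \<ge> 0}"

definition fin_neg_roots :: "root set" where
  "fin_neg_roots = {\<alpha> \<in> fin_roots. \<forall>i. Poly_Mapping.lookup \<alpha> i \<le> 0}"

text \<open>Restriction of a root to the Cartan subalgebra of the finite-dimensional subalgebra.\<close>

definition restr :: "root \<Rightarrow> weight" where
  "restr \<alpha> = (\<Sum>j=1..n. Poly_Mapping.single j (\<Sum>i\<le>n. A j i * Poly_Mapping.lookup \<alpha> i))"

definition weights :: "weight set" where
  "weights = {lam. Poly_Mapping.keys lam \<subseteq> {1..n}}"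

definition dominant :: "weight set" where
  "dominant = {lam \<in> weights. \<forall>i\<in>{1..n}. Poly_Mapping.lookup lam i \<ge> 0}"

definition antidominant :: "weight set" where
  "antidominant = {lam \<in> weights. \<forall>i\<in>{1..n}. Poly_Mapping.lookup lam i \<le> 0}"

text \<open>\<open>s\<^sub>i \<lambda> = \<lambda> - \<langle>\<lambda>, \<alpha>\<^sub>i\<^sup>\<or>\<rangle> \<alpha>\<^sub>i\<close>, where \<open>\<langle>\<alpha>\<^sub>i, \<alpha>\<^sub>j\<^sup>\<or>\<rangle> = A j i\<close>.\<close>

definition weight_refl :: "nat \<Rightarrow> weight \<Rightarrow> weight" where
  "weight_refl i lam = lam - (\<Sum>j=1..n. Poly_Mapping.single j (Poly_Mapping.lookup lam i * A j i))"

definition fin_weyl :: "(weight \<Rightarrow> weight) set" where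
  "fin_weyl = refl_word weight_refl ` lists {1..n}"

definition weyl_length :: "(weight \<Rightarrow> weight) \<Rightarrow> nat" where
  "weyl_length w = (LEAST k. \<exists>is \<in> lists {1..n}. length is = k \<and> refl_word weight_refl is = w)"

definition longest :: "weight \<Rightarrow> weight" where
  "longest = (ARG_MAX weyl_length w. w \<in> fin_weyl)"

inductive_set restr_lattice :: "weight set" where
  zero: "0 \<in> restr_lattice"
| add: "\<lbrakk>\<alpha> \<in> affine_roots; \<beta> \<in> restr_lattice\<rbrakk> \<Longrightarrow> \<beta> + restr \<alpha> \<in> restr_lattice"
| diff: "\<lbrakk>\<alpha> \<in> affine_roots; \<beta> \<in> restr_lattice\<rbrakk> \<Longrightarrow> \<beta> - restr \<alpha> \<in> restr_lattice"

definition restr_lattice_pos :: "weight set" where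
  "restr_lattice_pos = {lam \<in> restr_lattice. \<exists>c :: root \<Rightarrow> real. (\<forall>\<alpha>\<in>fin_pos_roots. c \<alpha> \<ge> 0) \<and>
     (\<forall>j\<in>{1..n}. real_of_int (Poly_Mapping.lookup lam j) =
        (\<Sum>\<alpha>\<in>fin_pos_roots. c \<alpha> * real_of_int (Poly_Mapping.lookup (restr \<alpha>) j)))}"

definition weight_less :: "weight \<Rightarrow> weight \<Rightarrow> bool" where
  "weight_less \<mu> lam \<longleftrightarrow> lam - \<mu> \<in> restr_lattice_pos \<and> \<mu> \<noteq> lam"

end


section \<open>Irreducible characters of the finite-dimensional subalgebra\<close>

text \<open>
  By Serre's theorem, a module over the simple complex Lie algebra with Cartan matrix
  \<open>(A i j)\<close>, \<open>1 \<le> i, j \<le> n\<close>, is a complex vector space \<open>V\<close> with operators \<open>E i\<close>, \<open>F i\<close>, \<open>H i\<close>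
  (the action of the Chevalley generators) satisfying the Chevalley-Serre relations. Here \<open>V\<close> is
  a subspace of an ambient vector space with scalar multiplication \<open>sc\<close>, and the operators,
  which matter only on \<open>V\<close>, are linear on the ambient space.
\<close>

definition commutator :: "('v::ab_group_add \<Rightarrow> 'v) \<Rightarrow> ('v \<Rightarrow> 'v) \<Rightarrow> 'v \<Rightarrow> 'v" where
  "commutator X Y = (\<lambda>v. X (Y v) - Y (X v))"

definition is_module :: "nat \<Rightarrow> (nat \<Rightarrow> nat \<Rightarrow> int) \<Rightarrow> (complex \<Rightarrow> 'v::ab_group_add \<Rightarrow> 'v) \<Rightarrow> 'v set \<Rightarrow>
    (nat \<Rightarrow> 'v \<Rightarrow> 'v) \<Rightarrow> (nat \<Rightarrow> 'v \<Rightarrow> 'v) \<Rightarrow> (nat \<Rightarrow> 'v \<Rightarrow> 'v) \<Rightarrow> bool" where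
  "is_module n A sc V E F H \<longleftrightarrow>
     vector_space sc \<and> module.subspace sc V \<and>
     (\<forall>i\<in>{1..n}. \<forall>X\<in>{E i, F i, H i}. Vector_Spaces.linear sc sc X \<and> X ` V \<subseteq> V) \<and>
     (\<forall>i\<in>{1..n}. \<forall>j\<in>{1..n}. \<forall>v\<in>V.
        commutator (H i) (H j) v = 0 \<and>
        commutator (E i) (F j) v = (if i = j then H i v else 0) \<and>
        commutator (H i) (E j) v = sc (of_int (A i j)) (E j v) \<and>
        commutator (H i) (F j) v = sc (of_int (- A i j)) (F j v) \<and>
        (i \<noteq> j \<longrightarrow>
           (commutator (E i) ^^ nat (1 - A i j)) (E j) v = 0 \<and>
           (commutator (F i) ^^ nat (1 - A i j)) (F j) v = 0))"

definition is_irreducible_module :: "nat \<Rightarrow> (nat \<Rightarrow> nat \<Rightarrow> int) \<Rightarrow>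
    (complex \<Rightarrow> 'v::ab_group_add \<Rightarrow> 'v) \<Rightarrow> 'v set \<Rightarrow>
    (nat \<Rightarrow> 'v \<Rightarrow> 'v) \<Rightarrow> (nat \<Rightarrow> 'v \<Rightarrow> 'v) \<Rightarrow> (nat \<Rightarrow> 'v \<Rightarrow> 'v) \<Rightarrow> bool" where
  "is_irreducible_module n A sc V E F H \<longleftrightarrow>
     is_module n A sc V E F H \<and> V \<noteq> {0} \<and>
     (\<forall>U. module.subspace sc U \<and> U \<subseteq> V \<and>
        (\<forall>i\<in>{1..n}. E i ` U \<subseteq> U \<and> F i ` U \<subseteq> U \<and> H i ` U \<subseteq> U) \<longrightarrow> U = {0} \<or> U = V)"

definition weight_space :: "nat \<Rightarrow> (complex \<Rightarrow> 'v::ab_group_add \<Rightarrow> 'v) \<Rightarrow> 'v set \<Rightarrow>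
    (nat \<Rightarrow> 'v \<Rightarrow> 'v) \<Rightarrow> weight \<Rightarrow> 'v set" where
  "weight_space n sc V H \<mu> = {v \<in> V. \<forall>i\<in>{1..n}. H i v = sc (of_int (Poly_Mapping.lookup \<mu> i)) v}"

definition has_highest_weight :: "nat \<Rightarrow> (complex \<Rightarrow> 'v::ab_group_add \<Rightarrow> 'v) \<Rightarrow> 'v set \<Rightarrow>
    (nat \<Rightarrow> 'v \<Rightarrow> 'v) \<Rightarrow> (nat \<Rightarrow> 'v \<Rightarrow> 'v) \<Rightarrow> weight \<Rightarrow> bool" where
  "has_highest_weight n sc V E H \<Lambda> \<longleftrightarrow>
     (\<exists>v \<in> weight_space n sc V H \<Lambda>. v \<noteq> 0 \<and> (\<forall>i\<in>{1..n}. E i v = 0))"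

definition is_character :: "nat \<Rightarrow> (complex \<Rightarrow> 'v::ab_group_add \<Rightarrow> 'v) \<Rightarrow> 'v set \<Rightarrow>
    (nat \<Rightarrow> 'v \<Rightarrow> 'v) \<Rightarrow> rat group_ring \<Rightarrow> bool" where
  "is_character n sc V H ch \<longleftrightarrow>
     (\<forall>\<mu>. Poly_Mapping.lookup ch \<mu> =
        (if \<mu> \<in> weights n then of_nat (vector_space.dim sc (weight_space n sc V H \<mu>)) else 0))"

text \<open>
  Irreducible highest weight modules have countable dimension, so subspaces of a vector space
  of countably infinite dimension suffice to realize them.
\<close>

definition coord_scale :: "complex \<Rightarrow> (nat \<Rightarrow>\<^sub>0 complex) \<Rightarrow> (nat \<Rightarrow>\<^sub>0 complex)" where
  "coord_scale c = Poly_Mapping.map ((*) c)"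

definition irr_char :: "nat \<Rightarrow> (nat \<Rightarrow> nat \<Rightarrow> int) \<Rightarrow> weight \<Rightarrow> rat group_ring" where
  "irr_char n A lam = (THE ch. \<exists>V E F H.
     is_irreducible_module n A coord_scale V E F H \<and>
     has_highest_weight n coord_scale V E H (longest n A lam) \<and>
     is_character n coord_scale V H ch)"


section \<open>Macdonald polynomials\<close>

text \<open>
  The variables of formal series are \<open>X = q\<^sup>-\<^sup>1\<^sup>/\<^sup>a\<close> with \<open>a = a\<^sub>0\<close> and, where \<open>t\<close> is present,
  \<open>Y = 1/t\<close>. Power series in \<open>X\<close> and \<open>Y\<close> over \<open>R\<close> are elements of \<^typ>\<open>'r fps fps\<close> with \<open>X\<close> as
  the outer variable, since it is in the \<open>X\<close>-adic topology that the products over roots converge.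
\<close>

definition expand_q :: "Fq \<Rightarrow> rat fls" where
  "expand_q = eval_ratfun fls_const fls_X_inv"

definition expand_qt :: "Fqt \<Rightarrow> rat fls fls" where
  "expand_qt = eval_ratfun (eval_ratfun (\<lambda>c. fls_const (fls_const c)) fls_X_inv) (fls_const fls_X_inv)"

text \<open>Inversion of \<open>q\<close> and \<open>t\<close>, then the involution of the group ring.\<close>

definition bar_scalar :: "Fqt \<Rightarrow> Fqt" where
  "bar_scalar = eval_ratfun
     (eval_ratfun (\<lambda>c. Fraction_Field.Fract [:Fraction_Field.Fract [:c:] 1:] 1)
        (Fraction_Field.Fract [:inverse ratvar:] 1))
     (inverse ratvar)"

definition bar :: "Fqt group_ring \<Rightarrow> Fqt group_ring" where
  "bar f = (\<Sum>\<nu>\<in>Poly_Mapping.keys f. Poly_Mapping.single (- \<nu>) (bar_scalar (Poly_Mapping.lookup f \<nu>)))"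

context
  fixes n :: nat and A :: "nat \<Rightarrow> nat \<Rightarrow> int"
begin

text \<open>
  For \<open>\<alpha> = \<Sum>\<^sub>i k\<^sub>i \<alpha>\<^sub>i\<close> one has \<open>\<alpha> = restr \<alpha> + (k\<^sub>0 / a\<^sub>0) \<delta>\<close>, whence \<open>e\<^sup>\<alpha> = X\<^sup>k e\<^sup>\<mu>\<close> with \<open>k = k\<^sub>0\<close>
  and \<open>\<mu> = restr \<alpha>\<close> under the convention \<open>e\<^sup>\<delta> = q\<^sup>-\<^sup>1\<close>. All roots used below have \<open>k\<^sub>0 \<ge> 0\<close>.
\<close>

definition exp_root :: "root \<Rightarrow> rat group_ring fps" where
  "exp_root \<alpha> = fps_const (Poly_Mapping.single (restr n A \<alpha>) 1) * fps_X ^ nat (Poly_Mapping.lookup \<alpha> 0)"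

definition exp_root_t :: "root \<Rightarrow> rat group_ring fps fps" where
  "exp_root_t \<alpha> =
     fps_const (fps_const (Poly_Mapping.single (restr n A \<alpha>) 1)) * fps_X ^ nat (Poly_Mapping.lookup \<alpha> 0)"

definition nabla_qt :: "rat group_ring fps fps" where
  "nabla_qt = formal_prod (fin_neg_roots n A \<union> pos_real_roots n A)
     (\<lambda>\<alpha>. exact_quot (1 - exp_root_t \<alpha>) (1 - fps_const fps_X * exp_root_t \<alpha>))"

definition nabla_qt_coeff :: "weight \<Rightarrow> rat fls fls" where
  "nabla_qt_coeff \<nu> =
     fps_to_fls (Abs_fps (\<lambda>i. fps_to_fls (Abs_fps (\<lambda>j. Poly_Mapping.lookup (fps_nth (fps_nth nabla_qt i) j) \<nu>))))"

definition Delta_qt_coeff :: "weight \<Rightarrow> rat fls fls" where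
  "Delta_qt_coeff \<nu> = nabla_qt_coeff \<nu> / nabla_qt_coeff 0"

text \<open>The scalar product \<open>[f bar(g) \<Delta>(q,t)]\<close>; its values are expanded as Laurent series.\<close>

definition scalar_qt :: "Fqt group_ring \<Rightarrow> Fqt group_ring \<Rightarrow> rat fls fls" where
  "scalar_qt f g =
     (\<Sum>\<nu>\<in>Poly_Mapping.keys (f * bar g). expand_qt (Poly_Mapping.lookup (f * bar g) \<nu>) * Delta_qt_coeff (- \<nu>))"

definition orbit_sum :: "weight \<Rightarrow> Fqt group_ring" where
  "orbit_sum lam = (\<Sum>\<mu>\<in>(\<lambda>w. w lam) ` fin_weyl n A. Poly_Mapping.single \<mu> 1)"

definition invariants :: "Fqt group_ring set" where
  "invariants = {f. Poly_Mapping.keys f \<subseteq> weights n \<and> (\<forall>w\<in>fin_weyl n A. \<forall>\<nu>\<in>weights n. Poly_Mapping.lookup f (w \<nu>) = Poly_Mapping.lookup f \<nu>)}"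

text \<open>
  Conditions (a) and (b): \<open>P lam\<close> has leading term the orbit sum of \<open>w\<^sub>\<circ>(\<lambda>)\<close>, and the \<open>P lam\<close> are
  pairwise orthogonal. On antidominant weights they determine \<open>P\<close>.
\<close>

definition macdonald_family :: "(weight \<Rightarrow> Fqt group_ring) \<Rightarrow> bool" where
  "macdonald_family P \<longleftrightarrow>
     (\<forall>lam\<in>antidominant n. P lam \<in> invariants \<and>
        (\<exists>M c. finite M \<and> M \<subseteq> {\<mu> \<in> dominant n. weight_less n A \<mu> (longest n A lam)} \<and>
           P lam - orbit_sum (longest n A lam) =
             (\<Sum>\<mu>\<in>M. Poly_Mapping.single 0 (c \<mu>) * orbit_sum \<mu>))) \<and>
     (\<forall>lam\<in>antidominant n. \<forall>\<mu>\<in>antidominant n. lam \<noteq> \<mu> \<longrightarrow> scalar_qt (P lam) (P \<mu>) = 0)"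

text \<open>\<open>p\<close> is the coefficientwise limit of \<open>f\<close> for \<open>t \<rightarrow> \<infinity>\<close>.\<close>

definition is_limit_t :: "Fqt group_ring \<Rightarrow> Fq group_ring \<Rightarrow> bool" where
  "is_limit_t f p \<longleftrightarrow>
     (\<forall>\<nu>. ratfun_lim_infinity (Poly_Mapping.lookup f \<nu>) (Poly_Mapping.lookup p \<nu>))"


section \<open>The limit scalar products\<close>

text \<open>
  These are defined on Laurent series in \<open>X\<close> over the rational group ring. Scalars in \<open>rat fls\<close>,
  elements of the rational group ring, and elements of the group ring over \<^typ>\<open>Fq\<close> are
  embedded by \<open>series_of_scalar\<close>, \<^const>\<open>fls_const\<close> and \<open>series_of\<close>, respectively.
\<close>

definition series_of_scalar :: "rat fls \<Rightarrow> rat group_ring fls" where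
  "series_of_scalar = fls_map (Poly_Mapping.single 0)"

definition series_of :: "Fq group_ring \<Rightarrow> rat group_ring fls" where
  "series_of f = (\<Sum>\<nu>\<in>Poly_Mapping.keys f. fls_map (Poly_Mapping.single \<nu>) (expand_q (Poly_Mapping.lookup f \<nu>)))"

text \<open>The coefficient \<open>[f]\<close> of \<open>e\<^sup>0\<close>.\<close>

definition const_term :: "rat group_ring fls \<Rightarrow> rat fls" where
  "const_term = fls_map (\<lambda>p. Poly_Mapping.lookup p 0)"

definition iota :: "rat group_ring fls \<Rightarrow> rat group_ring fls" where
  "iota = fls_map (\<lambda>p. \<Sum>\<nu>\<in>Poly_Mapping.keys p. Poly_Mapping.single (- longest n A \<nu>) (Poly_Mapping.lookup p \<nu>))"

definition nabla_q :: "rat group_ring fls" where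
  "nabla_q = fps_to_fls (formal_prod (fin_neg_roots n A \<union> pos_real_roots n A) (\<lambda>\<alpha>. 1 - exp_root \<alpha>))"

definition Delta_q :: "rat group_ring fls" where
  "Delta_q = series_of_scalar (inverse (const_term nabla_q)) * nabla_q"

definition Delta_infinity :: "rat group_ring fls" where
  "Delta_infinity = fls_const (Poly_Mapping.single 0 (1 / of_nat (card (fin_weyl n A))) *
     (\<Prod>\<alpha>\<in>fin_roots n A. 1 - Poly_Mapping.single (restr n A \<alpha>) 1))"

definition scalar_q :: "rat group_ring fls \<Rightarrow> rat group_ring fls \<Rightarrow> rat fls" where
  "scalar_q f g = const_term (f * iota g * Delta_q)"

definition scalar_infinity :: "rat group_ring fls \<Rightarrow> rat group_ring fls \<Rightarrow> rat fls" where
  "scalar_infinity f g = const_term (f * iota g * Delta_infinity)"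

definition S_q :: "rat group_ring fls" where
  "S_q = exact_quot Delta_q Delta_infinity"

end

end

theory Submission
  imports Defs
begin

text \<open>
  If \<open>S(q)\<close> is an invertible series, then \<open>S(q) \<Delta>(\<infinity>, \<infinity>) = \<Delta>(q, \<infinity>)\<close> turns the left-hand side into
  \<open>[\<chi> P\<^sup>\<iota> \<Delta>(\<infinity>, \<infinity>)]\<close>, so the claim is that \<open>\<chi>\<close> and \<open>P\<close> may exchange the involution under the
  constant term. The polynomial \<open>P\<close> is invariant under the finite Weyl group, as a limit of invariants;
  on invariants \<open>\<iota>\<close> is just \<open>e\<^sup>\<nu> \<mapsto> e\<^sup>-\<^sup>\<nu>\<close>. Applying \<open>\<iota>\<close>, which preserves constant terms, to the whole
  product then gives \<open>[\<chi>\<^sup>\<iota> P \<Delta>(\<infinity>, \<infinity>)]\<close>, because \<open>\<Delta>(\<infinity>, \<infinity>)\<close> is invariant under the Weyl group and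
  under \<open>e\<^sup>\<nu> \<mapsto> e\<^sup>-\<^sup>\<nu>\<close> (\<open>const_coeff_adjoint\<close>).

  The work lies in the invertibility of \<open>S(q)\<close> (\<open>S_q_unit\<close>). The product over the affine roots has to
  split into the product over the finite roots, the \<open>discriminant\<close>, and a convergent product of
  factors in \<open>1 + X \<cdot> (power series)\<close>, where \<open>X\<close> is the series variable \<open>q\<^sup>-\<^sup>1\<^sup>/\<^sup>a\<close>; and the constant term
  of the discriminant, by which one divides, must not vanish. It does not: the discriminant is
  \<open>D(e) D(e\<^sup>-\<^sup>1)\<close> with \<open>D\<close> the product over the positive roots, so its constant term is the sum of the
  squares of the coefficients of \<open>D\<close>. The splitting uses three facts about the real roots, read off
  from an invariant positive semidefinite form on the root lattice:

  \<^item> only finitely many real roots have a given coefficient at \<open>\<alpha>\<^sub>0\<close>, since the form takes finitely many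
    values on them and controls all coordinates once that one is fixed;

  \<^item> every real root is positive or negative. Write \<open>\<alpha> = \<beta> - \<gamma>\<close> with \<open>\<beta>, \<gamma>\<close> nonnegative of disjoint
    supports; then \<open>|\<alpha>|\<^sup>2 \<ge> |\<beta>|\<^sup>2 + |\<gamma>|\<^sup>2\<close>, and an integrality property of real roots makes either
    summand at least \<open>|\<alpha>|\<^sup>2\<close> if both are nonzero (\<open>root_like_sign\<close>);

  \<^item> a real root whose coefficient at \<open>\<alpha>\<^sub>0\<close> vanishes is a finite root, by descent on the height
    (\<open>root_like_nonneg_fin_root\<close>).

  The form exists because affine Cartan matrices are symmetrizable (\<open>affine_symmetrizable\<close>). Applied to
  the transposed matrix, the first fact also gives the finiteness of the Weyl group, and thereby the
  existence of the longest element.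
\<close>

section \<open>Symmetrizing an affine Cartan matrix\<close>

text \<open>
  The hypothesis \<open>leaf\<close> says that the graph of nonzero entries is a forest. A vertex with at most one
  neighbour can be removed, and a symmetrizer of the rest extends to it, since there is at most one
  equation to satisfy.
\<close>

lemma symmetrizer_of_forest:
  fixes A :: "nat \<Rightarrow> nat \<Rightarrow> int"
  assumes "finite I"
    and leaf: "\<And>J. J \<subseteq> I \<Longrightarrow> J \<noteq> {} \<Longrightarrow> \<exists>i\<in>J. \<exists>k. \<forall>j\<in>J. j \<noteq> i \<longrightarrow> j \<noteq> k \<longrightarrow> A i j = 0"
    and neg: "\<And>i j. i \<in> I \<Longrightarrow> j \<in> I \<Longrightarrow> i \<noteq> j \<Longrightarrow> A i j \<le> 0"
    and zero: "\<And>i j. i \<in> I \<Longrightarrow> j \<in> I \<Longrightarrow> A i j = 0 \<Longrightarrow> A j i = 0"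
  shows "\<exists>d :: nat \<Rightarrow> real. (\<forall>i\<in>I. d i > 0) \<and> (\<forall>i\<in>I. \<forall>j\<in>I. d i * A i j = d j * A j i)"
  using assms
proof (induction I rule: finite_psubset_induct)
  case (psubset I)
  show ?case
  proof (cases "I = {}")
    case False
    then obtain i k where i: "i \<in> I" and k: "\<And>j. j \<in> I \<Longrightarrow> j \<noteq> i \<Longrightarrow> j \<noteq> k \<Longrightarrow> A i j = 0"
      using psubset.prems(1)[of I] by blast
    have "\<exists>d :: nat \<Rightarrow> real. (\<forall>i\<in>I - {i}. d i > 0) \<and>
        (\<forall>a\<in>I - {i}. \<forall>b\<in>I - {i}. d a * A a b = d b * A b a)"
    proof (rule psubset.IH)
      show "I - {i} \<subset> I" using i by blast
      show "\<exists>a\<in>J. \<exists>k. \<forall>b\<in>J. b \<noteq> a \<longrightarrow> b \<noteq> k \<longrightarrow> A a b = 0" if "J \<subseteq> I - {i}" "J \<noteq> {}" for J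
        using psubset.prems(1)[of J] that by blast
    qed (use psubset.prems(2,3) in auto)
    then obtain d :: "nat \<Rightarrow> real" where d: "\<And>a. a \<in> I - {i} \<Longrightarrow> d a > 0"
        "\<And>a b. a \<in> I - {i} \<Longrightarrow> b \<in> I - {i} \<Longrightarrow> d a * A a b = d b * A b a" by blast
    define c where "c = (if k \<in> I - {i} \<and> A i k \<noteq> 0 then d k * A k i / A i k else 1)"
    have c: "c > 0"
    proof (cases "k \<in> I - {i} \<and> A i k \<noteq> 0")
      case True
      then have "A i k < 0" "A k i < 0"
        using psubset.prems(2)[of i k] psubset.prems(2)[of k i] psubset.prems(3)[of k i] i
        by fastforce+
      then show ?thesis using True d(1)[of k]
        by (simp add: c_def zero_less_divide_iff mult_less_0_iff)
    qed (auto simp: c_def)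
    have row: "c * A i b = d b * A b i" if b: "b \<in> I - {i}" for b
    proof (cases "A i b = 0")
      case True
      then show ?thesis using psubset.prems(3)[of i b] i b by simp
    next
      case False
      then have "b = k" using k b by blast
      then show ?thesis using False b by (simp add: c_def)
    qed
    let ?d = "d(i := c)"
    have "\<forall>a\<in>I. ?d a > 0" using c d by auto
    moreover have "?d a * A a b = ?d b * A b a" if "a \<in> I" "b \<in> I" for a b
      using row[of a] row[of b] d(2)[of a b] that by (cases "a = i"; cases "b = i") auto
    ultimately show ?thesis by blast
  qed auto
qed

text \<open>
  Conjugating by the null vector \<open>u\<close> turns the off-diagonal part of \<open>- A\<close> into a nonnegative matrix \<open>b\<close>
  with row sums \<open>2\<close>, and \<open>b i j * b j i = A i j * A j i \<ge> 1\<close> on edges, so \<open>b i j + b j i \<ge> 2\<close> there. If the graph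
  is not a forest, it has a set \<open>J\<close> of vertices with at least two neighbours in \<open>J\<close> each, and adding up
  the rows of \<open>b\<close> over \<open>J\<close> leaves no slack: \<open>J\<close> is everything (the matrix is that of a cycle) and
  \<open>b\<close> is symmetric.
\<close>

lemma affine_symmetrizable:
  assumes aff: "affine_cartan_matrix n A"
  shows "\<exists>(d :: nat \<Rightarrow> real) (u :: nat \<Rightarrow> real). (\<forall>i\<le>n. d i > 0) \<and> (\<forall>i\<le>n. u i > 0) \<and>
    (\<forall>i\<le>n. \<forall>j\<le>n. d i * A i j = d j * A j i) \<and> (\<forall>i\<le>n. (\<Sum>j\<le>n. A i j * u j) = 0)"
proof -
  note affine = aff[unfolded affine_cartan_matrix_def mat_app_def]
  have diag: "\<And>i. i \<le> n \<Longrightarrow> A i i = 2"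
    using affine[THEN conjunct1] by blast
  have neg: "\<And>i j. i \<le> n \<Longrightarrow> j \<le> n \<Longrightarrow> i \<noteq> j \<Longrightarrow> A i j \<le> 0"
    using affine[THEN conjunct2, THEN conjunct1] by blast
  have zero: "\<And>i j. i \<le> n \<Longrightarrow> j \<le> n \<Longrightarrow> A i j = 0 \<Longrightarrow> A j i = 0"
    using affine[THEN conjunct2, THEN conjunct2, THEN conjunct1] by blast
  have conn: "\<And>J. J \<noteq> {} \<Longrightarrow> J \<subset> {..n} \<Longrightarrow> \<exists>i\<in>J. \<exists>j\<in>{..n} - J. A i j \<noteq> 0"
    using affine[THEN conjunct2, THEN conjunct2, THEN conjunct2, THEN conjunct1] by blast
  obtain u :: "nat \<Rightarrow> real" where u: "\<And>i. i \<le> n \<Longrightarrow> u i > 0" "\<And>i. i \<le> n \<Longrightarrow> (\<Sum>j\<le>n. A i j * u j) = 0"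
    using affine[THEN conjunct2, THEN conjunct2, THEN conjunct2, THEN conjunct2, THEN conjunct1]
    by (elim exE conjE) blast
  have "\<exists>d :: nat \<Rightarrow> real. (\<forall>i\<in>{..n}. d i > 0) \<and> (\<forall>i\<in>{..n}. \<forall>j\<in>{..n}. d i * A i j = d j * A j i)"
  proof (cases "\<forall>J. J \<subseteq> {..n} \<longrightarrow> J \<noteq> {} \<longrightarrow> (\<exists>i\<in>J. \<exists>k. \<forall>j\<in>J. j \<noteq> i \<longrightarrow> j \<noteq> k \<longrightarrow> A i j = 0)")
    case True
    then show ?thesis
      by (intro symmetrizer_of_forest) (auto simp: neg zero)
  next
    case False
    then obtain J where J: "J \<subseteq> {..n}" "J \<noteq> {}"
      and no_leaf: "\<not> (\<exists>i\<in>J. \<exists>k. \<forall>j\<in>J. j \<noteq> i \<longrightarrow> j \<noteq> k \<longrightarrow> A i j = 0)"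
      unfolding not_all not_imp by (elim exE conjE)
    have nb2: "\<exists>j\<in>J. j \<noteq> i \<and> j \<noteq> k \<and> A i j \<noteq> 0" if "i \<in> J" for i k
      using no_leaf that by metis
    have finJ: "finite J" using J finite_subset by blast
    have Jn: "i \<le> n" if "i \<in> J" for i using J that by auto
    define b where "b i j = (if i = j then 0 else - (A i j * u j / u i))" for i j
    define N where "N i = {j \<in> J. j \<noteq> i \<and> A i j \<noteq> 0}" for i
    have b_nonneg: "b i j \<ge> 0" if "i \<le> n" "j \<le> n" for i j
      using that neg[of i j] u(1)[of i] u(1)[of j]
      by (auto simp: b_def divide_nonpos_pos mult_nonpos_nonneg)
    have b_row: "(\<Sum>j\<le>n. b i j) = 2" if i: "i \<le> n" for i
    proof -
      have "(\<Sum>j\<le>n. b i j) = (\<Sum>j\<le>n. (if j = i then 2 else 0) - A i j * u j / u i)"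
        using i diag[OF i] u(1)[OF i] by (intro sum.cong) (auto simp: b_def)
      also have "\<dots> = 2 - (\<Sum>j\<le>n. A i j * u j) / u i"
        using i by (simp add: sum_subtractf sum_divide_distrib)
      finally show ?thesis using u(2)[OF i] by simp
    qed
    have b_prod: "b i j * b j i \<ge> 1" if "i \<in> J" "j \<in> N i" for i j
    proof -
      have ij: "i \<le> n" "j \<le> n" "i \<noteq> j" "A i j \<noteq> 0" using that Jn by (auto simp: N_def)
      then have "A i j < 0" "A j i < 0" using neg[of i j] neg[of j i] zero[of j i] by fastforce+
      then have "1 \<le> A i j * A j i"
        by (metis mult_neg_neg int_one_le_iff_zero_less)
      moreover have "b i j * b j i = real_of_int (A i j * A j i)"
        using ij u(1)[of i] u(1)[of j] by (simp add: b_def field_simps)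
      ultimately show ?thesis by linarith
    qed
    have amgm: "b i j + b j i \<ge> 2" if "i \<in> J" "j \<in> N i" for i j
    proof -
      have "4 * (b i j * b j i) \<le> (b i j + b j i)\<^sup>2"
        using zero_le_power2[of "b i j - b j i"] by (simp add: power2_eq_square algebra_simps)
      then have "2\<^sup>2 \<le> (b i j + b j i)\<^sup>2" using b_prod[OF that] by simp
      moreover have "0 \<le> b i j + b j i" using b_nonneg that Jn by (simp add: N_def)
      ultimately show ?thesis by (rule power2_le_imp_le)
    qed
    \<comment> \<open>Twice the excess over the arithmetic-geometric bound; its total over \<open>J\<close> is at once nonnegative and nonpositive.\<close>
    define e where "e i j = b i j + b j i - (if j \<in> N i then 2 else 0)" for i j
    have e_nonneg: "e i j \<ge> 0" if "i \<in> J" "j \<in> J" for i j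
      using amgm[of i j] b_nonneg[of i j] b_nonneg[of j i] that Jn by (auto simp: e_def)
    have card2: "card (N i) \<ge> 2" if iJ: "i \<in> J" for i
    proof -
      obtain j where j: "j \<in> N i" using nb2[OF iJ, of i] by (auto simp: N_def)
      obtain k where k: "k \<in> N i" "k \<noteq> j" using nb2[OF iJ, of j] by (auto simp: N_def)
      have "card {j, k} \<le> card (N i)" using j k finJ by (intro card_mono) (auto simp: N_def)
      then show ?thesis using k by simp
    qed
    define r where "r i = (\<Sum>j\<in>J. b i j) - card (N i)" for i
    have Jsum: "(\<Sum>j\<in>J. b i j) \<le> 2" if "i \<in> J" for i
      unfolding b_row[OF Jn[OF that], symmetric]
      using J that by (intro sum_mono2) (auto intro!: b_nonneg)
    have r_nonpos: "r i \<le> 0" if "i \<in> J" for i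
      using Jsum[OF that] card2[OF that] by (simp add: r_def)
    have e_sum: "(\<Sum>i\<in>J. \<Sum>j\<in>J. e i j) = 2 * (\<Sum>i\<in>J. r i)"
    proof -
      have "(\<Sum>j\<in>J. if j \<in> N i then 2 else 0) = 2 * real (card (N i))" for i
      proof -
        have "J \<inter> N i = N i" by (auto simp: N_def)
        then show ?thesis using finJ by (simp add: sum.If_cases Int_commute)
      qed
      then have "(\<Sum>i\<in>J. \<Sum>j\<in>J. e i j) = (\<Sum>i\<in>J. \<Sum>j\<in>J. b i j) + (\<Sum>i\<in>J. \<Sum>j\<in>J. b j i) - (\<Sum>i\<in>J. 2 * real (card (N i)))"
        by (simp add: e_def sum.distrib sum_subtractf)
      also have "(\<Sum>i\<in>J. \<Sum>j\<in>J. b j i) = (\<Sum>i\<in>J. \<Sum>j\<in>J. b i j)" by (rule sum.swap)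
      finally show ?thesis by (simp add: r_def sum_subtractf sum_distrib_left)
    qed
    have "(\<Sum>i\<in>J. \<Sum>j\<in>J. e i j) \<ge> 0" by (intro sum_nonneg e_nonneg)
    moreover have "(\<Sum>i\<in>J. r i) \<le> 0" by (intro sum_nonpos r_nonpos)
    ultimately have e0: "(\<Sum>i\<in>J. \<Sum>j\<in>J. e i j) = 0" and r0: "(\<Sum>i\<in>J. r i) = 0"
      using e_sum by auto
    have e_zero: "e i j = 0" if "i \<in> J" "j \<in> J" for i j
    proof -
      have "(\<Sum>j\<in>J. e i j) = 0"
        using e0 that finJ by (subst (asm) sum_nonneg_eq_0_iff) (auto intro!: sum_nonneg e_nonneg)
      then show ?thesis
        using that finJ by (subst (asm) sum_nonneg_eq_0_iff) (auto intro!: sum_nonneg e_nonneg)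
    qed
    have r_zero: "r i = 0" if "i \<in> J" for i
      using sum_nonneg_eq_0_iff[OF finJ, of "\<lambda>i. - r i"] r0 that r_nonpos by (auto simp: sum_negf)
    have J_full: "J = {..n}"
    proof (rule ccontr)
      assume "J \<noteq> {..n}"
      then obtain i j where ij: "i \<in> J" "j \<le> n" "j \<notin> J" "A i j \<noteq> 0"
        using conn[of J] J by blast
      have "b i j + (\<Sum>j\<in>J. b i j) = (\<Sum>j\<in>insert j J. b i j)" using ij finJ by simp
      also have "\<dots> \<le> (\<Sum>j\<le>n. b i j)"
        using ij J Jn by (intro sum_mono2) (auto intro!: b_nonneg)
      finally have "b i j \<le> 0" using b_row[of i] r_zero[of i] card2[of i] ij Jn by (simp add: r_def)
      moreover have "b i j > 0"
        using neg[of i j] ij Jn[of i] u(1)[of i] u(1)[of j]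
        by (auto simp: b_def divide_neg_pos mult_neg_pos)
      ultimately show False by simp
    qed
    have b_sym: "b i j = b j i" if "i \<in> J" "j \<in> J" for i j
    proof (cases "j \<in> N i")
      case True
      have s: "b i j + b j i = 2" using e_zero[OF that] True by (simp add: e_def)
      have "(b i j - b j i)\<^sup>2 = (b i j + b j i)\<^sup>2 - 4 * (b i j * b j i)"
        by (simp add: power2_eq_square algebra_simps)
      also have "\<dots> \<le> 0" using s b_prod[OF that(1) True] by simp
      finally show ?thesis by simp
    next
      case False
      then show ?thesis using that zero[of i j] Jn by (auto simp: N_def b_def)
    qed
    have "1 / (u i)\<^sup>2 * A i j = 1 / (u j)\<^sup>2 * A j i" if "i \<le> n" "j \<le> n" for i j
    proof (cases "i = j")
      case False
      then have "A i j * u j / u i = A j i * u i / u j"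
        using b_sym[of i j] that J_full by (simp add: b_def)
      then show ?thesis using u(1)[OF that(1)] u(1)[OF that(2)]
        by (simp add: field_simps power2_eq_square)
    qed auto
    moreover have "0 < 1 / (u i)\<^sup>2" if "i \<le> n" for i using u(1)[OF that] by simp
    ultimately show ?thesis by (intro exI[of _ "\<lambda>i. 1 / (u i)\<^sup>2"]) simp
  qed
  then obtain d :: "nat \<Rightarrow> real" where "\<forall>i\<in>{..n}. d i > 0" "\<forall>i\<in>{..n}. \<forall>j\<in>{..n}. d i * A i j = d j * A j i" by blast
  then show ?thesis using u by (intro exI[of _ d] exI[of _ u]) auto
qed

section \<open>The invariant form and its integrality\<close>

lemma refl_word_Nil [simp]: "refl_word s [] = id"
  by (simp add: refl_word_def)

lemma refl_word_Cons [simp]: "refl_word s (i # is) x = s i (refl_word s is x)"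
  by (simp add: refl_word_def)

lemma refl_word_append: "refl_word s (is @ js) x = refl_word s is (refl_word s js x)"
  by (induction "is") auto

text \<open>
  Off-diagonal entries occur in equal pairs. This is what makes a form with even diagonal take even
  values on a lattice.
\<close>

lemma even_sum_symmetric:
  fixes N :: "nat \<Rightarrow> nat \<Rightarrow> int"
  assumes "\<And>i j. i \<le> n \<Longrightarrow> j \<le> n \<Longrightarrow> N i j = N j i" and "\<And>i. i \<le> n \<Longrightarrow> even (N i i)"
  shows "even (\<Sum>i\<le>n. \<Sum>j\<le>n. N i j)"
  using assms
proof (induction n)
  case (Suc n)
  have "(\<Sum>i\<le>n. N i (Suc n)) = (\<Sum>j\<le>n. N (Suc n) j)"
    by (intro sum.cong) (auto simp: Suc.prems(1))
  then have "(\<Sum>i\<le>Suc n. \<Sum>j\<le>Suc n. N i j) =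
      (\<Sum>i\<le>n. \<Sum>j\<le>n. N i j) + 2 * (\<Sum>j\<le>n. N (Suc n) j) + N (Suc n) (Suc n)"
    by (simp add: sum.distrib)
  then show ?case using Suc by simp
qed simp

text \<open>
  The data of a symmetrized affine Cartan matrix: \<open>d\<close> is the symmetrizer, \<open>u\<close> a positive null vector.
\<close>

locale affine_form =
  fixes n :: nat and A :: "nat \<Rightarrow> nat \<Rightarrow> int" and d u :: "nat \<Rightarrow> real"
  assumes diag: "\<And>i. i \<le> n \<Longrightarrow> A i i = 2"
    and off_diag: "\<And>i j. i \<le> n \<Longrightarrow> j \<le> n \<Longrightarrow> i \<noteq> j \<Longrightarrow> A i j \<le> 0"
    and connected: "\<And>J. J \<noteq> {} \<Longrightarrow> J \<subset> {..n} \<Longrightarrow> \<exists>i\<in>J. \<exists>j\<in>{..n} - J. A i j \<noteq> 0"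
    and d_pos: "\<And>i. i \<le> n \<Longrightarrow> d i > 0"
    and u_pos: "\<And>i. i \<le> n \<Longrightarrow> u i > 0"
    and sym: "\<And>i j. i \<le> n \<Longrightarrow> j \<le> n \<Longrightarrow> d i * A i j = d j * A j i"
    and null: "\<And>i. i \<le> n \<Longrightarrow> (\<Sum>j\<le>n. A i j * u j) = 0"
begin

text \<open>
  The hypotheses are symmetric under transposition, so that all results about roots hold for coroots
  as well.
\<close>

lemma transposed: "affine_form n (\<lambda>i j. A j i) (\<lambda>i. 1 / d i) (\<lambda>i. d i * u i)"
proof
  show "\<exists>i\<in>J. \<exists>j\<in>{..n} - J. A j i \<noteq> 0" if J: "J \<noteq> {}" "J \<subset> {..n}" for J
  proof -
    obtain i j where ij: "i \<in> J" "j \<in> {..n} - J" "A i j \<noteq> 0" using connected[OF J] by blast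
    moreover have "A j i \<noteq> 0"
      using sym[of i j] d_pos[of i] d_pos[of j] ij J by auto
    ultimately show ?thesis by blast
  qed
  show "1 / d i * A j i = 1 / d j * A i j" if "i \<le> n" "j \<le> n" for i j
    using sym[OF that] d_pos[OF that(1)] d_pos[OF that(2)] by (simp add: field_simps)
  show "(\<Sum>j\<le>n. A j i * (d j * u j)) = 0" if i: "i \<le> n" for i
  proof -
    have "(\<Sum>j\<le>n. A j i * (d j * u j)) = (\<Sum>j\<le>n. d i * (A i j * u j))"
      using sym[OF i] by (intro sum.cong) (auto simp: algebra_simps)
    also have "\<dots> = 0" using null[OF i] by (simp flip: sum_distrib_left)
    finally show ?thesis .
  qed
qed (use diag off_diag d_pos u_pos in auto)

definition form :: "(nat \<Rightarrow> real) \<Rightarrow> (nat \<Rightarrow> real) \<Rightarrow> real" where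
  "form x y = (\<Sum>i\<le>n. \<Sum>j\<le>n. d i * A i j * x i * y j)"

lemma form_sym: "form x y = form y x"
proof -
  have "form x y = (\<Sum>j\<le>n. \<Sum>i\<le>n. d i * A i j * x i * y j)"
    unfolding form_def by (rule sum.swap)
  also have "\<dots> = form y x"
    unfolding form_def by (intro sum.cong) (auto simp: sym)
  finally show ?thesis .
qed

lemma form_diff_left: "form (\<lambda>j. x j - c * y j) z = form x z - c * form y z"
  by (simp add: form_def algebra_simps sum_subtractf sum_distrib_left)

lemma form_diff_square: "form (\<lambda>j. x j - c * y j) (\<lambda>j. x j - c * y j) = form x x - 2 * c * form y x + c\<^sup>2 * form y y"
  by (simp add: form_diff_left form_sym[of _ "\<lambda>j. x j - c * y j"] form_sym[of x y]
      power2_eq_square algebra_simps)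

text \<open>
  Since \<open>u\<close> lies in the radical, rescaling the coordinates by \<open>u\<close> displays the form as a weighted graph
  Laplacian.
\<close>

lemma form_sum_squares:
  "form x x = - (\<Sum>i\<le>n. \<Sum>j\<le>n. d i * A i j * u i * u j * (x i / u i - x j / u j)\<^sup>2) / 2"
proof -
  define z where "z i = x i / u i" for i
  define w where "w i j = d i * A i j * u i * u j" for i j
  have wsym: "w i j = w j i" if "i \<le> n" "j \<le> n" for i j
    using sym[OF that] by (simp add: w_def)
  have row: "(\<Sum>j\<le>n. w i j) = 0" if "i \<le> n" for i
  proof -
    have "(\<Sum>j\<le>n. w i j) = d i * u i * (\<Sum>j\<le>n. A i j * u j)"
      by (simp add: w_def sum_distrib_left algebra_simps)
    then show ?thesis using null[OF that] by simp
  qed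
  have 1: "(\<Sum>i\<le>n. \<Sum>j\<le>n. w i j * (z i)\<^sup>2) = 0"
    using row by (simp flip: sum_distrib_right)
  have 2: "(\<Sum>i\<le>n. \<Sum>j\<le>n. w i j * (z j)\<^sup>2) = 0"
  proof -
    have "(\<Sum>i\<le>n. \<Sum>j\<le>n. w i j * (z j)\<^sup>2) = (\<Sum>j\<le>n. \<Sum>i\<le>n. w i j * (z j)\<^sup>2)"
      by (rule sum.swap)
    also have "\<dots> = (\<Sum>j\<le>n. \<Sum>i\<le>n. w j i * (z j)\<^sup>2)"
      by (intro sum.cong) (auto simp: wsym)
    finally show ?thesis using 1 by simp
  qed
  have "form x x = (\<Sum>i\<le>n. \<Sum>j\<le>n. w i j * (z i * z j))"
    unfolding form_def w_def z_def
    by (intro sum.cong refl) (simp add: u_pos less_imp_neq[OF u_pos, symmetric])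
  moreover have "(\<Sum>i\<le>n. \<Sum>j\<le>n. w i j * (z i - z j)\<^sup>2) =
      (\<Sum>i\<le>n. \<Sum>j\<le>n. w i j * (z i)\<^sup>2) + (\<Sum>i\<le>n. \<Sum>j\<le>n. w i j * (z j)\<^sup>2)
      - 2 * (\<Sum>i\<le>n. \<Sum>j\<le>n. w i j * (z i * z j))"
    by (simp add: power2_diff algebra_simps sum.distrib sum_subtractf sum_distrib_left)
  ultimately show ?thesis using 1 2 by (simp add: w_def z_def)
qed

lemma form_nonneg_term:
  "i \<le> n \<Longrightarrow> j \<le> n \<Longrightarrow> 0 \<le> - (d i * A i j * u i * u j * (x i / u i - x j / u j)\<^sup>2)"
  using off_diag[of i j] d_pos[of i] u_pos[of i] u_pos[of j]
  by (cases "i = j") (auto simp: mult_nonpos_nonneg mult_nonneg_nonpos)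

lemma form_nonneg: "form x x \<ge> 0"
proof -
  have "0 \<le> (\<Sum>i\<le>n. \<Sum>j\<le>n. - (d i * A i j * u i * u j * (x i / u i - x j / u j)\<^sup>2))"
    by (intro sum_nonneg form_nonneg_term) auto
  then show ?thesis unfolding form_sum_squares by (simp add: sum_negf)
qed

lemma form_edge_bound:
  assumes ij: "i \<le> n" "j \<le> n"
  shows "- (d i * A i j * u i * u j * (x i / u i - x j / u j)\<^sup>2) \<le> 2 * form x x"
proof -
  let ?t = "\<lambda>i j. - (d i * A i j * u i * u j * (x i / u i - x j / u j)\<^sup>2)"
  have "?t i j \<le> (\<Sum>j\<le>n. ?t i j)"
    using ij by (intro member_le_sum form_nonneg_term) auto
  also have "\<dots> \<le> (\<Sum>i\<le>n. \<Sum>j\<le>n. ?t i j)"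
    using ij by (intro member_le_sum[of i _ "\<lambda>i. \<Sum>j\<le>n. ?t i j"] sum_nonneg form_nonneg_term) auto
  also have "\<dots> = 2 * form x x" unfolding form_sum_squares by (simp add: sum_negf)
  finally show ?thesis .
qed

text \<open>
  Each edge bounds the difference of the rescaled coordinates at its ends, and the graph is connected.
\<close>

lemma form_bounds_ratios:
  assumes "i \<le> n"
  shows "\<exists>K. \<forall>x. \<bar>x i / u i - x 0 / u 0\<bar> \<le> K * sqrt (form x x)"
proof -
  define J where "J = {i. i \<le> n \<and> (\<exists>K. \<forall>x. \<bar>x i / u i - x 0 / u 0\<bar> \<le> K * sqrt (form x x))}"
  have "\<forall>x. \<bar>x 0 / u 0 - x 0 / u 0\<bar> \<le> 0 * sqrt (form x x)" by simp
  then have "0 \<in> J" unfolding J_def by blast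
  have "J = {..n}"
  proof (rule ccontr)
    assume "J \<noteq> {..n}"
    moreover have "J \<subseteq> {..n}" by (auto simp: J_def)
    ultimately have "J \<subset> {..n}" "J \<noteq> {}" using \<open>0 \<in> J\<close> by blast+
    then obtain i j where ij: "i \<in> J" "j \<le> n" "j \<notin> J" "A i j \<noteq> 0" using connected[of J] by blast
    then have i: "i \<le> n" by (simp add: J_def)
    obtain K where K: "\<And>x. \<bar>x i / u i - x 0 / u 0\<bar> \<le> K * sqrt (form x x)"
      using ij by (auto simp: J_def)
    define c where "c = - (d i * A i j * u i * u j)"
    have "real_of_int (A i j) < 0" using off_diag[of i j] ij i by fastforce
    then have c: "c > 0" using d_pos[OF i] u_pos[OF i] u_pos[OF ij(2)]
      by (simp add: c_def mult_pos_neg mult_neg_pos)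
    have "\<bar>x j / u j - x 0 / u 0\<bar> \<le> (sqrt (2 / c) + K) * sqrt (form x x)" for x
    proof -
      have "(x i / u i - x j / u j)\<^sup>2 \<le> 2 / c * form x x"
        using form_edge_bound[OF i ij(2), of x] c by (simp add: c_def field_simps)
      then have "\<bar>x i / u i - x j / u j\<bar> \<le> sqrt (2 / c * form x x)"
        by (simp add: real_le_rsqrt)
      also have "\<dots> = sqrt (2 / c) * sqrt (form x x)" by (rule real_sqrt_mult)
      finally show ?thesis using K[of x] unfolding distrib_right by linarith
    qed
    then have "j \<in> J" using ij by (auto simp: J_def)
    then show False using ij by simp
  qed
  then show ?thesis using assms by (auto simp: J_def)
qed

lemma form_pos:
  assumes k: "k \<le> n" "x k = 0" and i: "i \<le> n" "x i \<noteq> 0"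
  shows "form x x > 0"
proof (rule ccontr)
  assume "\<not> form x x > 0"
  then have "form x x = 0" using form_nonneg[of x] by simp
  then have eq: "x j / u j = x 0 / u 0" if j: "j \<le> n" for j
  proof -
    obtain K where "\<bar>x j / u j - x 0 / u 0\<bar> \<le> K * sqrt (form x x)"
      using form_bounds_ratios[OF j] by blast
    then show ?thesis using \<open>form x x = 0\<close> by simp
  qed
  have "x i / u i = x k / u k" using eq i k by metis
  then show False using k i u_pos[of i] by simp
qed

definition real_vec :: "root \<Rightarrow> nat \<Rightarrow> real" where
  "real_vec \<alpha> i = real_of_int (Poly_Mapping.lookup \<alpha> i)"

abbreviation norm2 :: "root \<Rightarrow> real" where
  "norm2 \<alpha> \<equiv> form (real_vec \<alpha>) (real_vec \<alpha>)"

definition pairing :: "nat \<Rightarrow> root \<Rightarrow> int" where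
  "pairing i \<alpha> = (\<Sum>j\<le>n. A i j * Poly_Mapping.lookup \<alpha> j)"

lemma lookup_root_refl:
  "Poly_Mapping.lookup (root_refl n A i \<alpha>) j = Poly_Mapping.lookup \<alpha> j - (if j = i then pairing i \<alpha> else 0)"
  by (simp add: root_refl_def pairing_def lookup_minus lookup_single when_def)

lemma form_unit_left:
  fixes y :: "nat \<Rightarrow> real"
  assumes i: "i \<le> n"
  shows "form (\<lambda>j. if j = i then 1 else 0) y = d i * (\<Sum>j\<le>n. A i j * y j)"
proof -
  have "form (\<lambda>j. if j = i then 1 else 0) y = (\<Sum>k\<le>n. if k = i then \<Sum>j\<le>n. d i * A i j * y j else 0)"
    unfolding form_def by (intro sum.cong) (auto intro!: sum.neutral)
  then show ?thesis using i by (simp add: sum_distrib_left mult.assoc)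
qed

lemma norm2_root_refl:
  assumes i: "i \<le> n"
  shows "norm2 (root_refl n A i \<alpha>) = norm2 \<alpha>"
proof -
  let ?e = "\<lambda>j. if j = i then 1 else (0::real)"
  have 1: "real_vec (root_refl n A i \<alpha>) = (\<lambda>j. real_vec \<alpha> j - pairing i \<alpha> * ?e j)"
    by (auto simp: real_vec_def lookup_root_refl)
  have 2: "form ?e (real_vec \<alpha>) = d i * pairing i \<alpha>"
    using i by (simp add: form_unit_left pairing_def real_vec_def)
  have 3: "form ?e ?e = 2 * d i"
    using i by (simp add: form_unit_left diag if_distrib cong: if_cong)
  show ?thesis unfolding 1 form_diff_square 2 3 by (simp add: power2_eq_square)
qed

text \<open>
  For \<open>\<alpha>\<close> of square length \<open>2 c\<close>, the numbers \<open>d j * \<alpha> j / c\<close> are the coefficients of the coroot of \<open>\<alpha>\<close> in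
  the simple coroots. The predicate thus says that \<open>\<alpha>\<close> and its coroot are both integral. It is invariant
  under the simple reflections and inherited, as far as integrality goes, by every part of \<open>\<alpha>\<close>
  obtained by restricting the support.
\<close>

definition root_like :: "real \<Rightarrow> root \<Rightarrow> bool" where
  "root_like c \<alpha> \<longleftrightarrow> c > 0 \<and> Poly_Mapping.keys \<alpha> \<subseteq> {..n} \<and> norm2 \<alpha> = 2 * c \<and>
     (\<forall>j\<le>n. d j * real_vec \<alpha> j / c \<in> \<int>)"

lemma root_like_simple: "i \<le> n \<Longrightarrow> root_like (d i) (Poly_Mapping.single i 1)"
proof -
  assume i: "i \<le> n"
  have e: "real_vec (Poly_Mapping.single i 1) = (\<lambda>j. if j = i then 1 else 0)"
    by (auto simp: real_vec_def lookup_single when_def)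
  show ?thesis unfolding root_like_def e
    using i d_pos[OF i] by (auto simp: form_unit_left diag if_distrib cong: if_cong)
qed

lemma root_like_refl:
  assumes i: "i \<le> n" and \<alpha>: "root_like c \<alpha>"
  shows "root_like c (root_refl n A i \<alpha>)"
proof -
  have c: "c > 0" and int: "\<And>j. j \<le> n \<Longrightarrow> d j * real_vec \<alpha> j / c \<in> \<int>"
    using \<alpha> by (auto simp: root_like_def)
  have "d i * pairing i \<alpha> / c = (\<Sum>j\<le>n. d i * A i j * real_vec \<alpha> j / c)"
    by (simp add: pairing_def real_vec_def sum_distrib_left sum_divide_distrib mult.assoc)
  also have "\<dots> = (\<Sum>j\<le>n. A j i * (d j * real_vec \<alpha> j / c))"
    by (intro sum.cong) (auto simp: sym[OF i])
  also have "\<dots> \<in> \<int>" by (intro Ints_sum Ints_mult int) auto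
  finally have p: "d i * pairing i \<alpha> / c \<in> \<int>" .
  have "d j * real_vec (root_refl n A i \<alpha>) j / c \<in> \<int>" if j: "j \<le> n" for j
  proof -
    have "d j * real_vec (root_refl n A i \<alpha>) j / c =
        d j * real_vec \<alpha> j / c - (if j = i then d i * pairing i \<alpha> / c else 0)"
      by (auto simp: real_vec_def lookup_root_refl right_diff_distrib diff_divide_distrib)
    then show ?thesis using int[OF j] p by simp
  qed
  moreover have "Poly_Mapping.keys (root_refl n A i \<alpha>) \<subseteq> {..n}"
  proof
    fix j assume "j \<in> Poly_Mapping.keys (root_refl n A i \<alpha>)"
    then have "Poly_Mapping.lookup \<alpha> j \<noteq> 0 \<or> j = i"
      by (auto simp: in_keys_iff lookup_root_refl split: if_splits)
    then show "j \<in> {..n}" using i \<alpha> by (auto simp: root_like_def in_keys_iff subset_iff)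
  qed
  ultimately show ?thesis using \<alpha> norm2_root_refl[OF i] by (simp add: root_like_def)
qed

lemma real_roots_root_like:
  assumes "\<alpha> \<in> real_roots n A"
  shows "\<exists>i\<le>n. root_like (d i) \<alpha>"
proof -
  obtain "is" i where w: "set is \<subseteq> {..n}" and i: "i \<le> n"
    and \<alpha>: "\<alpha> = refl_word (root_refl n A) is (Poly_Mapping.single i 1)"
    using assms by (auto simp: real_roots_def)
  have "root_like (d i) (refl_word (root_refl n A) is (Poly_Mapping.single i 1))"
    using w by (induction "is") (auto simp: root_like_simple[OF i] root_like_refl)
  then show ?thesis using i \<alpha> by blast
qed

text \<open>
  Divided by \<open>c\<close>, the square length of \<open>\<beta>\<close> is the sum of an integral symmetric matrix with even diagonal,
  hence an even integer.
\<close>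

lemma norm2_dichotomy:
  assumes c: "c > 0" and int: "\<And>j. j \<le> n \<Longrightarrow> d j * real_vec \<beta> j / c \<in> \<int>"
    and pos: "norm2 \<beta> > 0"
  shows "norm2 \<beta> \<ge> 2 * c"
proof -
  define y where "y j = \<lfloor>d j * real_vec \<beta> j / c\<rfloor>" for j
  have y: "of_int (y j) = d j * real_vec \<beta> j / c" if "j \<le> n" for j
    using int[OF that] by (auto simp: y_def elim: Ints_cases)
  define N where "N i j = y i * A i j * Poly_Mapping.lookup \<beta> j" for i j
  have N: "of_int (N i j) = d i * A i j * real_vec \<beta> i * real_vec \<beta> j / c" if "i \<le> n" for i j
    using y[OF that] by (simp add: N_def real_vec_def mult_ac)
  have "even (\<Sum>i\<le>n. \<Sum>j\<le>n. N i j)"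
  proof (rule even_sum_symmetric)
    fix i j assume ij: "i \<le> n" "j \<le> n"
    have "of_int (N i j) = (of_int (N j i) :: real)"
      using ij N[of i j] N[of j i] sym[OF ij] by (simp add: mult_ac)
    then show "N i j = N j i" by linarith
  qed (simp add: N_def diag)
  then obtain m where m: "(\<Sum>i\<le>n. \<Sum>j\<le>n. N i j) = 2 * m" by (rule evenE)
  have "norm2 \<beta> / c = of_int (\<Sum>i\<le>n. \<Sum>j\<le>n. N i j)"
    unfolding form_def by (simp add: sum_divide_distrib N)
  then have eq: "norm2 \<beta> = 2 * c * of_int m" using c m by (simp add: field_simps)
  then have "m \<ge> 1" using pos c by (simp add: zero_less_mult_iff)
  then have "1 \<le> real_of_int m" by simp
  then have "2 * c * 1 \<le> 2 * c * real_of_int m" using c by (intro mult_left_mono) auto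
  then show ?thesis using eq by simp
qed

text \<open>
  A vector \<open>\<alpha>\<close> of mixed sign would be \<open>\<beta> - \<gamma>\<close> with \<open>\<beta>\<close> and \<open>\<gamma>\<close> nonzero of disjoint supports. Each vanishes
  somewhere, so neither is isotropic and each has square length at least \<open>2 c\<close>; as their inner product
  is not positive, \<open>\<alpha>\<close> has square length at least \<open>4 c\<close>.
\<close>

lemma root_like_sign:
  assumes \<alpha>: "root_like c \<alpha>"
  shows "(\<forall>i. Poly_Mapping.lookup \<alpha> i \<ge> 0) \<or> (\<forall>i. Poly_Mapping.lookup \<alpha> i \<le> 0)"
proof (rule ccontr)
  assume "\<not> ?thesis"
  then obtain i k where ik: "Poly_Mapping.lookup \<alpha> i > 0" "Poly_Mapping.lookup \<alpha> k < 0"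
    unfolding de_Morgan_disj not_all not_le by blast
  have "Poly_Mapping.keys \<alpha> \<subseteq> {..n}" using \<alpha> by (simp add: root_like_def)
  moreover have "i \<in> Poly_Mapping.keys \<alpha>" "k \<in> Poly_Mapping.keys \<alpha>"
    using ik by (simp_all add: in_keys_iff)
  ultimately have n: "i \<le> n" "k \<le> n" by blast+
  have c: "c > 0" and int: "\<And>j. j \<le> n \<Longrightarrow> d j * real_vec \<alpha> j / c \<in> \<int>"
    and norm: "norm2 \<alpha> = 2 * c" using \<alpha> by (auto simp: root_like_def)
  define \<beta> where "\<beta> = Poly_Mapping.map (\<lambda>a. max a 0) \<alpha>"
  define \<gamma> where "\<gamma> = Poly_Mapping.map (\<lambda>a. max (- a) 0) \<alpha>"
  have \<beta>: "Poly_Mapping.lookup \<beta> j = max (Poly_Mapping.lookup \<alpha> j) 0"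
    and \<gamma>: "Poly_Mapping.lookup \<gamma> j = max (- Poly_Mapping.lookup \<alpha> j) 0" for j
    by (auto simp: \<beta>_def \<gamma>_def Poly_Mapping.map.rep_eq when_def)
  have "norm2 \<beta> > 0"
    using ik n by (intro form_pos[of k _ i]) (auto simp: real_vec_def \<beta>)
  moreover have "d j * real_vec \<beta> j / c \<in> \<int>" if "j \<le> n" for j
    using int[OF that] by (auto simp: real_vec_def \<beta> max_def)
  ultimately have 1: "norm2 \<beta> \<ge> 2 * c" by (intro norm2_dichotomy c)
  have "norm2 \<gamma> > 0"
    using ik n by (intro form_pos[of i _ k]) (auto simp: real_vec_def \<gamma>)
  moreover have "d j * real_vec \<gamma> j / c \<in> \<int>" if "j \<le> n" for j
    using int[OF that] by (auto simp: real_vec_def \<gamma> max_def)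
  ultimately have 2: "norm2 \<gamma> \<ge> 2 * c" by (intro norm2_dichotomy c)
  have "d p * A p q * real_vec \<gamma> p * real_vec \<beta> q \<le> 0" if "p \<le> n" "q \<le> n" for p q
  proof (cases "p = q")
    case True
    then show ?thesis by (auto simp: real_vec_def \<beta> \<gamma> max_def)
  next
    case False
    have "d p * A p q \<le> 0" using off_diag[OF that False] d_pos[OF that(1)] by (simp add: mult_nonneg_nonpos)
    moreover have "real_vec \<gamma> p \<ge> 0" "real_vec \<beta> q \<ge> 0" by (simp_all add: real_vec_def \<beta> \<gamma>)
    ultimately show ?thesis by (simp add: mult_nonpos_nonneg)
  qed
  then have 3: "form (real_vec \<gamma>) (real_vec \<beta>) \<le> 0"
    unfolding form_def by (intro sum_nonpos) auto
  have "real_vec \<alpha> = (\<lambda>j. real_vec \<beta> j - 1 * real_vec \<gamma> j)"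
    by (auto simp: real_vec_def \<beta> \<gamma> max_def)
  then have "norm2 \<alpha> = norm2 \<beta> - 2 * form (real_vec \<gamma>) (real_vec \<beta>) + norm2 \<gamma>"
    using form_diff_square[of "real_vec \<beta>" 1 "real_vec \<gamma>"] by simp
  then show False using 1 2 3 c norm by simp
qed

text \<open>
  The form is only semidefinite, with radical spanned by \<open>u\<close>; fixing the coordinate \<open>0\<close> removes that
  freedom.
\<close>

lemma finite_bounded_norm2:
  "finite {\<alpha>. Poly_Mapping.keys \<alpha> \<subseteq> {..n} \<and> Poly_Mapping.lookup \<alpha> 0 = k \<and> norm2 \<alpha> \<le> C}"
    (is "finite ?S")
proof -
  have "\<exists>K. \<forall>i\<le>n. \<forall>x. \<bar>x i / u i - x 0 / u 0\<bar> \<le> K i * sqrt (form x x)"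
    using form_bounds_ratios by metis
  then obtain K where K: "\<And>i x. i \<le> n \<Longrightarrow> \<bar>x i / u i - x 0 / u 0\<bar> \<le> K i * sqrt (form x x)" by blast
  define B where "B i = u i * (\<bar>K i\<bar> * sqrt C + \<bar>real_of_int k / u 0\<bar>)" for i
  have bound: "\<bar>real_vec \<alpha> i\<bar> \<le> B i" if \<alpha>: "\<alpha> \<in> ?S" and i: "i \<le> n" for \<alpha> i
  proof -
    have "K i * sqrt (norm2 \<alpha>) \<le> \<bar>K i\<bar> * sqrt C"
      using \<alpha> form_nonneg[of "real_vec \<alpha>"] by (intro mult_mono) auto
    then have "\<bar>real_vec \<alpha> i / u i - real_vec \<alpha> 0 / u 0\<bar> \<le> \<bar>K i\<bar> * sqrt C"
      using K[OF i, of "real_vec \<alpha>"] by linarith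
    then have "\<bar>real_vec \<alpha> i / u i\<bar> \<le> \<bar>K i\<bar> * sqrt C + \<bar>real_of_int k / u 0\<bar>"
      using \<alpha> abs_triangle_ineq2[of "real_vec \<alpha> i / u i" "real_vec \<alpha> 0 / u 0"]
      by (simp only: real_vec_def mem_Collect_eq)
    then show ?thesis using u_pos[OF i] by (simp add: B_def abs_divide field_simps)
  qed
  define M where "M = (\<Sum>i\<le>n. \<lceil>\<bar>B i\<bar>\<rceil>)"
  have M: "Poly_Mapping.lookup \<alpha> i \<in> {-M..M}" if \<alpha>: "\<alpha> \<in> ?S" for \<alpha> i
  proof (cases "i \<le> n")
    case True
    have "\<lceil>\<bar>B i\<bar>\<rceil> \<le> M" unfolding M_def using True by (intro member_le_sum) auto
    moreover have "real_of_int \<bar>Poly_Mapping.lookup \<alpha> i\<bar> \<le> \<bar>B i\<bar>"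
      using bound[OF \<alpha> True] by (simp add: real_vec_def)
    ultimately show ?thesis by (simp add: abs_le_iff) linarith
  next
    case False
    then have "Poly_Mapping.lookup \<alpha> i = 0" using \<alpha> by (auto simp: in_keys_iff subset_iff)
    moreover have "M \<ge> 0" unfolding M_def by (intro sum_nonneg) auto
    ultimately show ?thesis by simp
  qed
  let ?F = "{f. \<forall>i. (i \<in> {..n} \<longrightarrow> f i \<in> {-M..M}) \<and> (i \<notin> {..n} \<longrightarrow> f i = 0)}"
  have "Poly_Mapping.lookup ` ?S \<subseteq> ?F"
    using M by (auto simp: in_keys_iff subset_iff)
  moreover have "finite ?F" by (intro finite_set_of_finite_funs) auto
  ultimately have "finite (Poly_Mapping.lookup ` ?S)" by (rule finite_subset)
  then show ?thesis by (rule finite_imageD) (simp add: inj_on_def poly_mapping_eqI)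
qed

lemma finite_real_roots_degree: "finite {\<alpha> \<in> real_roots n A. Poly_Mapping.lookup \<alpha> 0 = k}"
proof (rule finite_subset[OF _ finite_bounded_norm2[of k "2 * (\<Sum>i\<le>n. d i)"]])
  have "norm2 \<alpha> \<le> 2 * (\<Sum>i\<le>n. d i) \<and> Poly_Mapping.keys \<alpha> \<subseteq> {..n}" if \<alpha>: "\<alpha> \<in> real_roots n A" for \<alpha>
  proof -
    obtain i where i: "i \<le> n" "root_like (d i) \<alpha>" using real_roots_root_like[OF \<alpha>] by blast
    have "d i \<le> (\<Sum>i\<le>n. d i)" using i d_pos by (intro member_le_sum) (auto intro: less_imp_le)
    then show ?thesis using i by (simp add: root_like_def)
  qed
  then show "{\<alpha> \<in> real_roots n A. Poly_Mapping.lookup \<alpha> 0 = k} \<subseteq>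
      {\<alpha>. Poly_Mapping.keys \<alpha> \<subseteq> {..n} \<and> Poly_Mapping.lookup \<alpha> 0 = k \<and> norm2 \<alpha> \<le> 2 * (\<Sum>i\<le>n. d i)}"
    by blast
qed

end

lemma affine_form_exists:
  assumes "affine_cartan_matrix n A"
  shows "\<exists>d u. affine_form n A d u"
proof -
  obtain d u :: "nat \<Rightarrow> real" where du: "\<forall>i\<le>n. d i > 0" "\<forall>i\<le>n. u i > 0"
      "\<forall>i\<le>n. \<forall>j\<le>n. d i * A i j = d j * A j i" "\<forall>i\<le>n. (\<Sum>j\<le>n. A i j * u j) = 0"
    using affine_symmetrizable[OF assms] by blast
  note affine = assms[unfolded affine_cartan_matrix_def]
  have "affine_form n A d u"
  proof
    show "\<And>i. i \<le> n \<Longrightarrow> A i i = 2" using affine[THEN conjunct1] by blast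
    show "\<And>i j. i \<le> n \<Longrightarrow> j \<le> n \<Longrightarrow> i \<noteq> j \<Longrightarrow> A i j \<le> 0"
      using affine[THEN conjunct2, THEN conjunct1] by blast
    show "\<And>J. J \<noteq> {} \<Longrightarrow> J \<subset> {..n} \<Longrightarrow> \<exists>i\<in>J. \<exists>j\<in>{..n} - J. A i j \<noteq> 0"
      using affine[THEN conjunct2, THEN conjunct2, THEN conjunct2, THEN conjunct1] by blast
  qed (use du in simp_all)
  then show ?thesis by blast
qed

section \<open>Finite roots and the finite Weyl group\<close>

lemma root_refl_simple_self: "A i i = 2 \<Longrightarrow> i \<le> n \<Longrightarrow> root_refl n A i (Poly_Mapping.single i 1) = - Poly_Mapping.single i 1"
  by (rule poly_mapping_eqI) (simp add: root_refl_def lookup_single lookup_minus when_def if_distrib cong: if_cong)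

lemma root_refl_uminus: "root_refl n A i (- \<alpha>) = - root_refl n A i \<alpha>"
  by (rule poly_mapping_eqI) (simp add: root_refl_def lookup_single lookup_minus when_def sum_negf)

lemma refl_word_root_refl_uminus:
  "refl_word (root_refl n A) is (- \<alpha>) = - refl_word (root_refl n A) is \<alpha>"
  by (induction "is") (auto simp: root_refl_uminus)

lemma fin_roots_subset_real_roots: "fin_roots n A \<subseteq> real_roots n A"
proof
  fix \<alpha> assume "\<alpha> \<in> fin_roots n A"
  then obtain "is" i where "set is \<subseteq> {1..n}" "i \<in> {1..n}"
      "\<alpha> = refl_word (root_refl n A) is (Poly_Mapping.single i 1)"
    by (auto simp: fin_roots_def)
  moreover from this have "set is \<subseteq> {..n}" "i \<le> n" by auto
  ultimately show "\<alpha> \<in> real_roots n A" unfolding real_roots_def by blast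
qed

lemma root_refl_fin_roots:
  assumes "\<alpha> \<in> fin_roots n A" "i \<in> {1..n}"
  shows "root_refl n A i \<alpha> \<in> fin_roots n A"
proof -
  obtain "is" j where "set is \<subseteq> {1..n}" "j \<in> {1..n}" "\<alpha> = refl_word (root_refl n A) is (Poly_Mapping.single j 1)"
    using assms by (auto simp: fin_roots_def)
  then show ?thesis using assms(2) unfolding fin_roots_def
    by (intro CollectI exI[of _ "i # is"] exI[of _ j]) auto
qed

lemma lookup_fin_roots_0:
  assumes "\<alpha> \<in> fin_roots n A"
  shows "Poly_Mapping.lookup \<alpha> 0 = 0"
proof -
  obtain "is" j where w: "set is \<subseteq> {1..n}" and j: "j \<in> {1..n}"
    and \<alpha>: "\<alpha> = refl_word (root_refl n A) is (Poly_Mapping.single j 1)"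
    using assms by (auto simp: fin_roots_def)
  have "Poly_Mapping.lookup (refl_word (root_refl n A) is (Poly_Mapping.single j 1)) 0 = 0"
    using w j by (induction "is") (auto simp: root_refl_def lookup_minus lookup_single)
  then show ?thesis using \<alpha> by simp
qed

lemma lookup_restr:
  "Poly_Mapping.lookup (restr n A \<alpha>) j =
    (if j \<in> {1..n} then \<Sum>i\<le>n. A j i * Poly_Mapping.lookup \<alpha> i else 0)"
  by (auto simp: restr_def lookup_sum lookup_single when_def cong: if_cong)

lemma lookup_weight_refl:
  "Poly_Mapping.lookup (weight_refl n A i lam) j =
    Poly_Mapping.lookup lam j - (if j \<in> {1..n} then Poly_Mapping.lookup lam i * A j i else 0)"
  by (auto simp: weight_refl_def lookup_minus lookup_sum lookup_single when_def cong: if_cong)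

lemma restr_uminus: "restr n A (- \<alpha>) = - restr n A \<alpha>"
  by (rule poly_mapping_eqI) (simp add: lookup_restr sum_negf)

lemma restr_root_refl:
  assumes i: "i \<in> {1..n}"
  shows "restr n A (root_refl n A i \<alpha>) = weight_refl n A i (restr n A \<alpha>)"
proof (rule poly_mapping_eqI)
  fix j
  have "(\<Sum>k\<le>n. A j k * Poly_Mapping.lookup (root_refl n A i \<alpha>) k) =
      (\<Sum>k\<le>n. A j k * Poly_Mapping.lookup \<alpha> k - (if k = i then A j i * (\<Sum>l\<le>n. A i l * Poly_Mapping.lookup \<alpha> l) else 0))"
    by (intro sum.cong) (auto simp: root_refl_def lookup_minus lookup_single algebra_simps)
  also have "\<dots> = (\<Sum>k\<le>n. A j k * Poly_Mapping.lookup \<alpha> k) - A j i * (\<Sum>l\<le>n. A i l * Poly_Mapping.lookup \<alpha> l)"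
    using i by (simp add: sum_subtractf)
  finally show "Poly_Mapping.lookup (restr n A (root_refl n A i \<alpha>)) j =
      Poly_Mapping.lookup (weight_refl n A i (restr n A \<alpha>)) j"
    using i by (simp add: lookup_restr lookup_weight_refl)
qed

context affine_form
begin

lemma uminus_fin_roots:
  assumes "\<alpha> \<in> fin_roots n A"
  shows "- \<alpha> \<in> fin_roots n A"
proof -
  obtain "is" i where w: "set is \<subseteq> {1..n}" and i: "i \<in> {1..n}"
    and \<alpha>: "\<alpha> = refl_word (root_refl n A) is (Poly_Mapping.single i 1)"
    using assms by (auto simp: fin_roots_def)
  have "- \<alpha> = refl_word (root_refl n A) (is @ [i]) (Poly_Mapping.single i 1)"
    using i by (simp add: \<alpha> refl_word_append root_refl_simple_self diag refl_word_root_refl_uminus)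
  moreover have "set (is @ [i]) \<subseteq> {1..n}" using w i by auto
  ultimately show ?thesis using i unfolding fin_roots_def by blast
qed

lemma root_refl_involutive: "i \<le> n \<Longrightarrow> root_refl n A i (root_refl n A i \<alpha>) = \<alpha>"
proof (rule poly_mapping_eqI)
  fix j assume i: "i \<le> n"
  have "pairing i (root_refl n A i \<alpha>) =
      (\<Sum>k\<le>n. A i k * Poly_Mapping.lookup \<alpha> k - (if k = i then 2 * pairing i \<alpha> else 0))"
    unfolding pairing_def[of i "root_refl n A i \<alpha>"] using diag[OF i]
    by (intro sum.cong) (auto simp: lookup_root_refl algebra_simps)
  also have "\<dots> = - pairing i \<alpha>" using i by (simp add: sum_subtractf pairing_def)
  finally show "Poly_Mapping.lookup (root_refl n A i (root_refl n A i \<alpha>)) j = Poly_Mapping.lookup \<alpha> j"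
    by (simp add: lookup_root_refl)
qed

lemma norm2_pairing: "norm2 \<alpha> = (\<Sum>i\<le>n. d i * real_vec \<alpha> i * pairing i \<alpha>)"
  unfolding form_def pairing_def
  by (simp add: real_vec_def sum_distrib_left mult_ac)

text \<open>
  If \<open>\<alpha> = k \<alpha>\<^sub>i\<close>, then its coroot is \<open>1 / k\<close> times the simple coroot, and integrality of both leaves \<open>k = 1\<close>.
\<close>

lemma root_like_multiple_of_simple:
  assumes \<alpha>: "root_like c \<alpha>" and i: "i \<le> n"
    and zero: "\<And>j. j \<noteq> i \<Longrightarrow> Poly_Mapping.lookup \<alpha> j = 0" and pos: "Poly_Mapping.lookup \<alpha> i > 0"
  shows "\<alpha> = Poly_Mapping.single i 1"
proof -
  define k where "k = Poly_Mapping.lookup \<alpha> i"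
  have c: "c > 0" and norm: "norm2 \<alpha> = 2 * c" and "d i * real_vec \<alpha> i / c \<in> \<int>"
    using \<alpha> i by (auto simp: root_like_def)
  then obtain y where y: "d i * k / c = of_int y"
    by (auto simp: real_vec_def k_def elim: Ints_cases)
  have p: "pairing i \<alpha> = 2 * k"
  proof -
    have "pairing i \<alpha> = (\<Sum>j\<le>n. if j = i then 2 * k else 0)"
      unfolding pairing_def using zero diag[OF i] by (intro sum.cong) (auto simp: k_def)
    then show ?thesis using i by simp
  qed
  have "norm2 \<alpha> = (\<Sum>j\<le>n. if j = i then d i * k * (2 * k) else 0)"
    unfolding norm2_pairing using zero p by (intro sum.cong) (auto simp: real_vec_def k_def)
  then have "d i * k * k = c" using i norm by simp
  then have "real_of_int y * real_of_int k = 1" using c y by (simp add: field_simps)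
  then have "real_of_int (y * k) = 1" by simp
  then have "y * k = 1" by linarith
  then have "k = 1" using pos by (auto simp: k_def zmult_eq_1_iff)
  then show ?thesis using zero
    by (intro poly_mapping_eqI) (auto simp: lookup_single when_def k_def)
qed

text \<open>
  A vector of positive square length pairs positively with some simple root in its support, and the
  corresponding reflection lowers its height. By the sign lemma the reflected vector is again
  nonnegative, unless only one coordinate is nonzero to begin with.
\<close>

lemma root_like_nonneg_fin_root:
  assumes "root_like c \<alpha>" "Poly_Mapping.lookup \<alpha> 0 = 0" "\<And>i. Poly_Mapping.lookup \<alpha> i \<ge> 0"
  shows "\<alpha> \<in> fin_roots n A"
  using assms
proof (induction "nat (\<Sum>i\<le>n. Poly_Mapping.lookup \<alpha> i)" arbitrary: \<alpha> rule: less_induct)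
  case less
  have "norm2 \<alpha> > 0" using less.prems(1) by (simp add: root_like_def)
  have "\<exists>i\<le>n. Poly_Mapping.lookup \<alpha> i > 0 \<and> pairing i \<alpha> > 0"
  proof (rule ccontr)
    assume neg: "\<not> ?thesis"
    have "d i * real_vec \<alpha> i * pairing i \<alpha> \<le> 0" if i: "i \<le> n" for i
    proof (cases "Poly_Mapping.lookup \<alpha> i > 0")
      case True
      then have "real_of_int (pairing i \<alpha>) \<le> 0" using neg i by fastforce
      then show ?thesis using True d_pos[OF i] by (simp add: real_vec_def mult_nonneg_nonpos)
    next
      case False
      then show ?thesis using less.prems(3)[of i] by (simp add: real_vec_def)
    qed
    then have "norm2 \<alpha> \<le> 0" unfolding norm2_pairing by (intro sum_nonpos) auto
    then show False using \<open>norm2 \<alpha> > 0\<close> by simp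
  qed
  then obtain i where i: "i \<le> n" "Poly_Mapping.lookup \<alpha> i > 0" "pairing i \<alpha> > 0" by blast
  have i1: "i \<in> {1..n}" using i less.prems(2) by (cases i) auto
  define \<beta> where "\<beta> = root_refl n A i \<alpha>"
  have \<beta>: "Poly_Mapping.lookup \<beta> j = Poly_Mapping.lookup \<alpha> j - (if j = i then pairing i \<alpha> else 0)" for j
    by (simp add: \<beta>_def lookup_root_refl)
  have rl: "root_like c \<beta>" unfolding \<beta>_def by (intro root_like_refl i less.prems)
  show ?case
  proof (cases "\<forall>j. Poly_Mapping.lookup \<beta> j \<ge> 0")
    case True
    have "(\<Sum>j\<le>n. Poly_Mapping.lookup \<beta> j) = (\<Sum>j\<le>n. Poly_Mapping.lookup \<alpha> j) - pairing i \<alpha>"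
      using i by (simp add: \<beta> sum_subtractf)
    moreover have "(\<Sum>j\<le>n. Poly_Mapping.lookup \<beta> j) \<ge> 0" using True by (intro sum_nonneg) auto
    ultimately have "\<beta> \<in> fin_roots n A"
      using i i1 True rl less.prems(2) by (intro less.hyps) (auto simp: \<beta>)
    then have "root_refl n A i \<beta> \<in> fin_roots n A" using i1 by (rule root_refl_fin_roots)
    then show ?thesis using i by (simp add: \<beta>_def root_refl_involutive)
  next
    case False
    then have nonpos: "\<forall>j. Poly_Mapping.lookup \<beta> j \<le> 0" using root_like_sign[OF rl] by blast
    have "Poly_Mapping.lookup \<alpha> j = 0" if "j \<noteq> i" for j
      using \<beta>[of j] less.prems(3)[of j] nonpos[rule_format, of j] that by simp
    then have "\<alpha> = Poly_Mapping.single i 1"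
      using i less.prems(1) by (intro root_like_multiple_of_simple) auto
    then show ?thesis using i1 unfolding fin_roots_def
      by (intro CollectI exI[of _ "[]"] exI[of _ i]) auto
  qed
qed

lemma fin_roots_eq: "fin_roots n A = {\<alpha> \<in> real_roots n A. Poly_Mapping.lookup \<alpha> 0 = 0}"
proof (intro set_eqI iffI)
  fix \<alpha> assume "\<alpha> \<in> {\<alpha> \<in> real_roots n A. Poly_Mapping.lookup \<alpha> 0 = 0}"
  then obtain c where c: "root_like c \<alpha>" and 0: "Poly_Mapping.lookup \<alpha> 0 = 0"
    using real_roots_root_like by blast
  show "\<alpha> \<in> fin_roots n A"
  proof (cases "\<forall>i. Poly_Mapping.lookup \<alpha> i \<ge> 0")
    case True
    then show ?thesis using c 0 root_like_nonneg_fin_root by blast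
  next
    case False
    then have "\<forall>i. Poly_Mapping.lookup \<alpha> i \<le> 0" using root_like_sign[OF c] by blast
    moreover have "real_vec (- \<alpha>) = (\<lambda>i. - real_vec \<alpha> i)" by (auto simp: real_vec_def)
    then have "root_like c (- \<alpha>)" using c by (simp add: root_like_def form_def)
    ultimately have "- \<alpha> \<in> fin_roots n A" using 0 by (intro root_like_nonneg_fin_root) auto
    then show ?thesis using uminus_fin_roots by fastforce
  qed
qed (use fin_roots_subset_real_roots lookup_fin_roots_0 in blast)

lemma finite_fin_roots: "finite (fin_roots n A)"
  unfolding fin_roots_eq by (rule finite_real_roots_degree)

lemma fin_root_sign:
  assumes "\<alpha> \<in> fin_roots n A"
  shows "(\<forall>i. Poly_Mapping.lookup \<alpha> i \<ge> 0) \<or> (\<forall>i. Poly_Mapping.lookup \<alpha> i \<le> 0)"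
proof -
  have "\<alpha> \<in> real_roots n A" using assms fin_roots_subset_real_roots by blast
  then obtain c where "root_like c \<alpha>" using real_roots_root_like by blast
  then show ?thesis by (rule root_like_sign)
qed

lemma fin_root_restr_nonzero:
  assumes \<alpha>: "\<alpha> \<in> fin_roots n A"
  shows "restr n A \<alpha> \<noteq> 0"
proof
  assume 0: "restr n A \<alpha> = 0"
  have "real_vec \<alpha> i * pairing i \<alpha> = 0" if "i \<le> n" for i
  proof (cases "i = 0")
    case True
    then show ?thesis using lookup_fin_roots_0[OF \<alpha>] by (simp add: real_vec_def)
  next
    case False
    then have "Poly_Mapping.lookup (restr n A \<alpha>) i = pairing i \<alpha>"
      using that by (simp add: lookup_restr pairing_def)
    then show ?thesis using 0 by simp
  qed
  then have "norm2 \<alpha> = 0" unfolding norm2_pairing by (intro sum.neutral) auto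
  moreover obtain c where "root_like c \<alpha>"
    using \<alpha> fin_roots_subset_real_roots real_roots_root_like by blast
  ultimately show False by (auto simp: root_like_def)
qed

text \<open>
  An element \<open>w\<close> is determined by the coordinates of \<open>w \<lambda>\<close>. The \<open>i\<close>-th one is the value of \<open>\<lambda>\<close> on the image
  of the \<open>i\<close>-th simple coroot under the inverse of \<open>w\<close>, which is one of finitely many finite coroots.
\<close>

lemma finite_fin_weyl: "finite (fin_weyl n A)"
proof -
  interpret dual: affine_form n "\<lambda>i j. A j i" "\<lambda>i. 1 / d i" "\<lambda>i. d i * u i" by (rule transposed)
  let ?co = "root_refl n (\<lambda>i j. A j i)"
  define ev where "ev lam h = (\<Sum>j=1..n. Poly_Mapping.lookup lam j * Poly_Mapping.lookup h j)" for lam h :: "nat \<Rightarrow>\<^sub>0 int"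
  have ev_refl: "ev (weight_refl n A i lam) h = ev lam (?co i h)"
    if i: "i \<in> {1..n}" and h: "Poly_Mapping.lookup h 0 = 0" for i lam h
  proof -
    have "(\<Sum>j\<le>n. A j i * Poly_Mapping.lookup h j) = (\<Sum>j=1..n. A j i * Poly_Mapping.lookup h j)"
      using h by (intro sum.mono_neutral_right) (auto simp: not_le)
    moreover have "ev lam (?co i h) = (\<Sum>j=1..n. Poly_Mapping.lookup lam j * Poly_Mapping.lookup h j -
        (if j = i then Poly_Mapping.lookup lam i * (\<Sum>k\<le>n. A k i * Poly_Mapping.lookup h k) else 0))"
      unfolding ev_def by (intro sum.cong) (auto simp: root_refl_def lookup_minus lookup_single algebra_simps)
    ultimately show ?thesis using i
      by (simp add: ev_def lookup_weight_refl sum_subtractf algebra_simps sum_distrib_left)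
  qed
  have ev_word: "ev (refl_word (weight_refl n A) is lam) h = ev lam (refl_word ?co (rev is) h)"
    if "set is \<subseteq> {1..n}" "Poly_Mapping.lookup h 0 = 0" for "is" lam h
    using that
  proof (induction "is" arbitrary: h)
    case (Cons i "is")
    have "Poly_Mapping.lookup (?co i h) 0 = 0"
      using Cons.prems by (simp add: root_refl_def lookup_minus lookup_single)
    then show ?case using Cons by (simp add: ev_refl refl_word_append)
  qed simp
  have outside: "Poly_Mapping.lookup (refl_word (weight_refl n A) is lam) j = Poly_Mapping.lookup lam j"
    if "j \<notin> {1..n}" for "is" lam j
    using that by (induction "is") (auto simp: lookup_weight_refl)
  \<comment> \<open>An element of the Weyl group is encoded by the images of the simple coroots under its inverse.\<close>
  define G where "G = {g. \<forall>i. (i \<in> {1..n} \<longrightarrow> g i \<in> fin_roots n (\<lambda>i j. A j i)) \<and> (i \<notin> {1..n} \<longrightarrow> g i = 0)}"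
  have "finite G" unfolding G_def
    using dual.finite_fin_roots by (intro finite_set_of_finite_funs) auto
  moreover have "\<exists>g\<in>G. \<forall>lam. \<forall>i\<in>{1..n}. Poly_Mapping.lookup (w lam) i = ev lam (g i)"
    if w: "w \<in> fin_weyl n A" for w
  proof -
    obtain "is" where is1: "set is \<subseteq> {1..n}" and w: "w = refl_word (weight_refl n A) is"
      using w by (auto simp: fin_weyl_def)
    let ?g = "\<lambda>i. if i \<in> {1..n} then refl_word ?co (rev is) (Poly_Mapping.single i 1) else 0"
    have "Poly_Mapping.lookup (w lam) i = ev lam (?g i)" if i: "i \<in> {1..n}" for lam i
    proof -
      have "Poly_Mapping.lookup (w lam) i = ev (w lam) (Poly_Mapping.single i 1)"
        using i by (simp add: ev_def lookup_single when_def if_distrib cong: if_cong)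
      also have "\<dots> = ev lam (?g i)"
        unfolding w using i by (subst ev_word[OF is1]) (auto simp: lookup_single)
      finally show ?thesis .
    qed
    moreover have "?g \<in> G" unfolding G_def fin_roots_def using is1
      by (auto intro!: exI[of _ "rev is"])
    ultimately show ?thesis by (intro bexI[of _ ?g] allI ballI)
  qed
  then obtain g where g: "\<And>w. w \<in> fin_weyl n A \<Longrightarrow> g w \<in> G"
      "\<And>w lam i. w \<in> fin_weyl n A \<Longrightarrow> i \<in> {1..n} \<Longrightarrow> Poly_Mapping.lookup (w lam) i = ev lam (g w i)"
    by metis
  have "inj_on g (fin_weyl n A)"
  proof (rule inj_onI)
    fix v w assume vw: "v \<in> fin_weyl n A" "w \<in> fin_weyl n A" "g v = g w"
    have "Poly_Mapping.lookup (v lam) j = Poly_Mapping.lookup (w lam) j" for lam j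
      using vw g(2)[of v j lam] g(2)[of w j lam] outside[of j _ lam]
      by (cases "j \<in> {1..n}") (auto simp: fin_weyl_def)
    then show "v = w" by (intro ext poly_mapping_eqI) auto
  qed
  moreover have "g ` fin_weyl n A \<subseteq> G" using g(1) by blast
  ultimately show ?thesis using \<open>finite G\<close> by (metis finite_subset finite_imageD)
qed

lemma longest_in_fin_weyl: "longest n A \<in> fin_weyl n A"
proof -
  let ?M = "Max (weyl_length n A ` fin_weyl n A)"
  have "id \<in> fin_weyl n A" unfolding fin_weyl_def by (rule image_eqI[of _ _ "[]"]) auto
  moreover have "weyl_length n A w < Suc ?M" if "w \<in> fin_weyl n A" for w
    using that finite_fin_weyl by (simp add: less_Suc_eq_le)
  ultimately show ?thesis unfolding longest_def
    using arg_max_nat_lemma[of "\<lambda>w. w \<in> fin_weyl n A" id "weyl_length n A" "Suc ?M"] by blast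
qed

end

lemma weight_refl_add: "weight_refl n A i (lam + \<nu>) = weight_refl n A i lam + weight_refl n A i \<nu>"
  by (rule poly_mapping_eqI) (simp add: lookup_weight_refl lookup_add algebra_simps)

lemma weight_refl_involutive:
  assumes "A i i = 2" "i \<in> {1..n}"
  shows "weight_refl n A i (weight_refl n A i lam) = lam"
  using assms by (intro poly_mapping_eqI) (simp add: lookup_weight_refl algebra_simps)

lemma fin_weyl_induct [consumes 1, case_names id refl]:
  assumes "w \<in> fin_weyl n A" and "Q (\<lambda>\<nu>. \<nu>)"
    and "\<And>i w. i \<in> {1..n} \<Longrightarrow> Q w \<Longrightarrow> Q (\<lambda>\<nu>. weight_refl n A i (w \<nu>))"
  shows "Q w"
proof -
  obtain "is" where is1: "set is \<subseteq> {1..n}" and w: "w = refl_word (weight_refl n A) is"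
    using assms(1) by (auto simp: fin_weyl_def)
  have "Q (refl_word (weight_refl n A) is)"
    using is1
  proof (induction "is")
    case Nil
    then show ?case using assms(2) by (simp add: id_def)
  next
    case (Cons i "is")
    then have "Q (\<lambda>\<nu>. weight_refl n A i (refl_word (weight_refl n A) is \<nu>))"
      using assms(3) by simp
    moreover have "refl_word (weight_refl n A) (i # is) = (\<lambda>\<nu>. weight_refl n A i (refl_word (weight_refl n A) is \<nu>))"
      by auto
    ultimately show ?case by simp
  qed
  then show ?thesis using w by simp
qed

lemma fin_weyl_add:
  assumes "w \<in> fin_weyl n A"
  shows "w (lam + \<nu>) = w lam + w \<nu>"
  using assms by (induction rule: fin_weyl_induct) (auto simp: weight_refl_add)

lemma fin_weyl_in_weights_iff:
  assumes "w \<in> fin_weyl n A"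
  shows "w \<nu> \<in> weights n \<longleftrightarrow> \<nu> \<in> weights n"
proof -
  have mem: "\<nu> \<in> weights n \<longleftrightarrow> (\<forall>j. j \<notin> {1..n} \<longrightarrow> Poly_Mapping.lookup \<nu> j = 0)" for \<nu>
    unfolding weights_def mem_Collect_eq subset_iff in_keys_iff by blast
  have "\<forall>j. j \<notin> {1..n} \<longrightarrow> Poly_Mapping.lookup (w \<nu>) j = Poly_Mapping.lookup \<nu> j"
    using assms by (induction rule: fin_weyl_induct) (auto simp: lookup_weight_refl)
  then show ?thesis unfolding mem by auto
qed

section \<open>Transport of group ring elements along maps of weights\<close>

text \<open>
  The linear map of group rings with \<open>e\<^sup>\<nu> \<mapsto> e\<^sup>\<phi>\<^sup>\<nu>\<close>. Weyl group elements, inversion of weights and \<open>\<iota>\<close> all act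
  in this way, and for additive \<open>\<phi>\<close> it is a ring homomorphism.
\<close>

definition push :: "('a \<Rightarrow> 'b) \<Rightarrow> ('a \<Rightarrow>\<^sub>0 'c::comm_monoid_add) \<Rightarrow> ('b \<Rightarrow>\<^sub>0 'c)" where
  "push \<phi> p = (\<Sum>\<nu>\<in>Poly_Mapping.keys p. Poly_Mapping.single (\<phi> \<nu>) (Poly_Mapping.lookup p \<nu>))"

lemma push_superset:
  "finite K \<Longrightarrow> Poly_Mapping.keys p \<subseteq> K \<Longrightarrow>
    push \<phi> p = (\<Sum>\<nu>\<in>K. Poly_Mapping.single (\<phi> \<nu>) (Poly_Mapping.lookup p \<nu>))"
  unfolding push_def by (intro sum.mono_neutral_left) (auto simp: in_keys_iff)

lemma push_zero [simp]: "push \<phi> 0 = 0"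
  by (simp add: push_def)

lemma push_single [simp]: "push \<phi> (Poly_Mapping.single \<nu> c) = Poly_Mapping.single (\<phi> \<nu>) c"
  by (subst push_superset[of "{\<nu>}"]) auto

lemma push_add: "push \<phi> (p + q) = push \<phi> p + push \<phi> q"
proof -
  let ?K = "Poly_Mapping.keys p \<union> Poly_Mapping.keys q"
  have "Poly_Mapping.keys (p + q) \<subseteq> ?K" by (rule keys_add)
  then show ?thesis
    by (simp add: push_superset[of ?K] lookup_add single_add sum.distrib)
qed

lemma push_sum: "push \<phi> (\<Sum>i\<in>I. f i) = (\<Sum>i\<in>I. push \<phi> (f i))"
  by (induction I rule: infinite_finite_induct) (auto simp: push_add)

lemma push_diff: "push \<phi> (p - q) = push \<phi> p - push \<phi> (q :: 'a \<Rightarrow>\<^sub>0 'c::ab_group_add)"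
  using push_add[of \<phi> "p - q" q] by simp

lemma push_id: "push (\<lambda>\<nu>. \<nu>) p = p"
proof (rule poly_mapping_eqI)
  fix k
  show "Poly_Mapping.lookup (push (\<lambda>\<nu>. \<nu>) p) k = Poly_Mapping.lookup p k"
    by (auto simp: push_def lookup_sum lookup_single when_def in_keys_iff cong: if_cong)
qed

lemma push_push: "push \<phi> (push \<psi> p) = push (\<lambda>\<nu>. \<phi> (\<psi> \<nu>)) p"
  unfolding push_def[of \<psi>] push_sum push_single by (simp add: push_def[of "\<lambda>\<nu>. \<phi> (\<psi> \<nu>)"])

lemma push_mult:
  fixes p q :: "'a::monoid_add \<Rightarrow>\<^sub>0 'c::comm_ring_1"
  assumes "\<And>\<mu> \<nu>. \<phi> (\<mu> + \<nu>) = \<phi> \<mu> + \<phi> \<nu>"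
  shows "push \<phi> (p * q) = push \<phi> p * (push \<phi> q :: 'b::monoid_add \<Rightarrow>\<^sub>0 'c)"
proof -
  have "p * q = push (\<lambda>\<nu>. \<nu>) p * push (\<lambda>\<nu>. \<nu>) q" by (simp add: push_id)
  then have "push \<phi> (p * q) = push \<phi> (push (\<lambda>\<nu>. \<nu>) p * push (\<lambda>\<nu>. \<nu>) q)" by simp
  also have "\<dots> = push \<phi> p * push \<phi> q"
    unfolding push_def[of "\<lambda>\<nu>. \<nu>"] push_def[of \<phi> p] push_def[of \<phi> q]
    by (simp add: sum_product push_sum mult_single assms)
  finally show ?thesis .
qed

lemma push_prod:
  fixes f :: "'i \<Rightarrow> 'a::comm_monoid_add \<Rightarrow>\<^sub>0 'c::comm_ring_1"
  assumes "\<And>\<mu> \<nu>. \<phi> (\<mu> + \<nu>) = \<phi> \<mu> + \<phi> \<nu>" and "\<phi> 0 = (0 :: 'b::comm_monoid_add)"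
  shows "push \<phi> (\<Prod>i\<in>I. f i) = (\<Prod>i\<in>I. push \<phi> (f i))"
proof -
  have one: "push \<phi> 1 = (1 :: 'b \<Rightarrow>\<^sub>0 'c)"
    using push_single[of \<phi> 0 "1::'c"] assms(2) by simp
  show ?thesis
    by (induction I rule: infinite_finite_induct) (auto simp: push_mult[of \<phi>, OF assms(1)] one)
qed

lemma lookup_push_inj:
  assumes "inj \<phi>"
  shows "Poly_Mapping.lookup (push \<phi> p) (\<phi> \<nu>) = Poly_Mapping.lookup p \<nu>"
proof -
  have "Poly_Mapping.lookup (push \<phi> p) (\<phi> \<nu>) =
      (\<Sum>\<mu>\<in>Poly_Mapping.keys p. if \<mu> = \<nu> then Poly_Mapping.lookup p \<mu> else 0)"
    unfolding push_def lookup_sum using assms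
    by (intro sum.cong) (auto simp: lookup_single when_def inj_eq)
  then show ?thesis by (simp add: in_keys_iff)
qed

text \<open>
  The constant term in question is the sum of the squares of the coefficients of \<open>p\<close>.
\<close>

lemma const_coeff_mult_push_uminus_pos:
  fixes p :: "'a::ab_group_add \<Rightarrow>\<^sub>0 rat"
  assumes "p \<noteq> 0"
  shows "Poly_Mapping.lookup (p * push uminus p) 0 > 0"
proof -
  let ?K = "Poly_Mapping.keys p"
  have "p * push uminus p = push (\<lambda>\<nu>. \<nu>) p * push uminus p" by (simp add: push_id)
  also have "\<dots> = (\<Sum>\<mu>\<in>?K. \<Sum>\<nu>\<in>?K. Poly_Mapping.single (\<mu> - \<nu>) (Poly_Mapping.lookup p \<mu> * Poly_Mapping.lookup p \<nu>))"
    by (simp add: push_def sum_product mult_single)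
  finally have "Poly_Mapping.lookup (p * push uminus p) 0 =
      (\<Sum>\<mu>\<in>?K. \<Sum>\<nu>\<in>?K. if \<nu> = \<mu> then Poly_Mapping.lookup p \<mu> * Poly_Mapping.lookup p \<nu> else 0)"
    by (auto simp: lookup_sum lookup_single when_def intro!: sum.cong)
  also have "\<dots> = (\<Sum>\<mu>\<in>?K. (Poly_Mapping.lookup p \<mu>)\<^sup>2)" by (simp add: power2_eq_square)
  also have "\<dots> > 0"
    using assms by (intro sum_pos) (auto simp: in_keys_iff)
  finally show ?thesis .
qed

lemma lookup_single_0_mult:
  fixes p :: "'a::monoid_add \<Rightarrow>\<^sub>0 'c::comm_ring_1"
  shows "Poly_Mapping.lookup (Poly_Mapping.single 0 c * p) \<nu> = c * Poly_Mapping.lookup p \<nu>"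
proof -
  have "Poly_Mapping.single 0 c * p = Poly_Mapping.single 0 c * push (\<lambda>\<nu>. \<nu>) p" by (simp add: push_id)
  also have "\<dots> = (\<Sum>\<nu>\<in>Poly_Mapping.keys p. Poly_Mapping.single \<nu> (c * Poly_Mapping.lookup p \<nu>))"
    by (simp add: push_def sum_distrib_left mult_single)
  finally show ?thesis
    by (auto simp: lookup_sum lookup_single when_def in_keys_iff cong: if_cong)
qed

lemma push_one_minus_exp:
  assumes "\<phi> 0 = 0"
  shows "push \<phi> (1 - Poly_Mapping.single \<nu> 1) = 1 - Poly_Mapping.single (\<phi> \<nu>) (1::rat)"
  using push_single[of \<phi> 0 "1::rat"] assms by (simp add: push_diff)

section \<open>Infinite products of power series\<close>

lemma fps_nth_mult_truncate:
  fixes g g' :: "'a::comm_ring_1 fps"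
  assumes "\<And>j. j \<le> k \<Longrightarrow> fps_nth g j = fps_nth g' j"
  shows "fps_nth (f * g) k = fps_nth (f * g') k"
  unfolding fps_mult_nth using assms by (intro sum.cong) auto

lemma eventually_finite_subsets_at_topE:
  assumes "eventually P (finite_subsets_at_top I)"
  obtains X where "finite X" "X \<subseteq> I" "\<forall>T. finite T \<and> X \<subseteq> T \<and> T \<subseteq> I \<longrightarrow> P T"
  using assms unfolding eventually_finite_subsets_at_top by (elim exE conjE)

text \<open>
  Only finitely many factors differ from \<open>1\<close> modulo \<open>X\<^sup>N\<^sup>+\<^sup>1\<close>, and once these are included the
  coefficient of \<open>X\<^sup>N\<close> no longer changes.
\<close>

lemma formal_prod_tendsto:
  fixes f :: "'i \<Rightarrow> 'a::comm_ring_1 fps"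
  assumes fin: "\<And>N. finite {i \<in> I. \<exists>k\<le>N. fps_nth (f i) k \<noteq> fps_nth 1 k}"
  shows "((\<lambda>T. \<Prod>i\<in>T. f i) \<longlongrightarrow> formal_prod I f) (finite_subsets_at_top I)"
proof -
  define J where "J N = {i \<in> I. \<exists>k\<le>N. fps_nth (f i) k \<noteq> fps_nth 1 k}" for N
  have stable: "fps_nth (\<Prod>i\<in>T. f i) N = fps_nth (\<Prod>i\<in>J N. f i) N"
    if T: "finite T" "J N \<subseteq> T" "T \<subseteq> I" for T N
  proof -
    have rest: "\<forall>k\<le>N. fps_nth (\<Prod>i\<in>U. f i) k = fps_nth 1 k" if "finite U" "U \<subseteq> I - J N" for U
      using that
    proof (induction U rule: finite_induct)
      case (insert i U)
      have i: "\<forall>k\<le>N. fps_nth (f i) k = fps_nth 1 k" using insert.prems by (auto simp: J_def)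
      show ?case
      proof (intro allI impI)
        fix k assume k: "k \<le> N"
        have "fps_nth (f i * (\<Prod>i\<in>U. f i)) k = fps_nth (f i * 1) k"
          using insert k by (intro fps_nth_mult_truncate) auto
        then show "fps_nth (\<Prod>i\<in>insert i U. f i) k = fps_nth 1 k"
          using insert.hyps i k by simp
      qed
    qed simp
    have "(\<Prod>i\<in>T. f i) = (\<Prod>i\<in>J N. f i) * (\<Prod>i\<in>T - J N. f i)"
      using T by (simp add: prod.subset_diff mult.commute)
    moreover have "fps_nth ((\<Prod>i\<in>J N. f i) * (\<Prod>i\<in>T - J N. f i)) N = fps_nth ((\<Prod>i\<in>J N. f i) * 1) N"
    proof (rule fps_nth_mult_truncate)
      have "finite (T - J N)" using T(1) by simp
      moreover have "T - J N \<subseteq> I - J N" using T(3) by blast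
      ultimately show "fps_nth (\<Prod>i\<in>T - J N. f i) k = fps_nth 1 k" if "k \<le> N" for k
        using rest that by blast
    qed
    ultimately show ?thesis by simp
  qed
  define L where "L = Abs_fps (\<lambda>N. fps_nth (\<Prod>i\<in>J N. f i) N)"
  have lim: "((\<lambda>T. \<Prod>i\<in>T. f i) \<longlongrightarrow> L) (finite_subsets_at_top I)"
  proof (rule tendsto_fpsI)
    fix N
    have "finite (J N)" "J N \<subseteq> I" using fin[of N] by (auto simp: J_def)
    moreover have "fps_nth (\<Prod>i\<in>T. f i) N = fps_nth L N" if "finite T \<and> J N \<subseteq> T \<and> T \<subseteq> I" for T
      using stable[of T N] that by (simp add: L_def)
    ultimately show "\<forall>\<^sub>F T in finite_subsets_at_top I. fps_nth (\<Prod>i\<in>T. f i) N = fps_nth L N"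
      unfolding eventually_finite_subsets_at_top by (intro exI[of _ "J N"] conjI allI impI)
  qed
  then have "formal_prod I f = L"
    unfolding formal_prod_def by (intro tendsto_Lim) auto
  then show ?thesis using lim by simp
qed

lemma formal_prod_eqI:
  assumes "((\<lambda>T. \<Prod>i\<in>T. f i) \<longlongrightarrow> L) (finite_subsets_at_top I)"
  shows "formal_prod I f = L"
  unfolding formal_prod_def using assms by (intro tendsto_Lim) auto

lemma formal_prod_split_finite:
  fixes f :: "'i \<Rightarrow> 'a::comm_ring_1 fps"
  assumes fin: "\<And>N. finite {i \<in> I. \<exists>k\<le>N. fps_nth (f i) k \<noteq> fps_nth 1 k}"
    and I0: "finite I0" "I0 \<inter> I = {}"
  shows "formal_prod (I0 \<union> I) f = (\<Prod>i\<in>I0. f i) * formal_prod I f"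
proof (rule formal_prod_eqI, rule tendsto_fpsI)
  fix N
  have "\<forall>\<^sub>F T in finite_subsets_at_top I. \<forall>k\<in>{..N}. fps_nth (\<Prod>i\<in>T. f i) k = fps_nth (formal_prod I f) k"
    using formal_prod_tendsto[OF fin] unfolding tendsto_fps_iff
    by (intro eventually_ball_finite) auto
  then obtain X where X: "finite X" "X \<subseteq> I"
    "\<forall>T. finite T \<and> X \<subseteq> T \<and> T \<subseteq> I \<longrightarrow> (\<forall>k\<in>{..N}. fps_nth (\<Prod>i\<in>T. f i) k = fps_nth (formal_prod I f) k)"
    by (rule eventually_finite_subsets_at_topE)
  have "fps_nth (\<Prod>i\<in>T. f i) N = fps_nth ((\<Prod>i\<in>I0. f i) * formal_prod I f) N"
    if "finite T \<and> I0 \<union> X \<subseteq> T \<and> T \<subseteq> I0 \<union> I" for T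
  proof -
    have T: "finite T" "I0 \<union> X \<subseteq> T" "T \<subseteq> I0 \<union> I" using that by blast+
    have "(\<Prod>i\<in>T. f i) = (\<Prod>i\<in>I0. f i) * (\<Prod>i\<in>T - I0. f i)"
      using T by (simp add: prod.subset_diff[of I0 T] mult.commute)
    also have "fps_nth \<dots> N = fps_nth ((\<Prod>i\<in>I0. f i) * formal_prod I f) N"
    proof (rule fps_nth_mult_truncate)
      have "X \<subseteq> T - I0" using T X(2) I0(2) by blast
      moreover have "T - I0 \<subseteq> I" using T(3) by blast
      ultimately show "fps_nth (\<Prod>i\<in>T - I0. f i) k = fps_nth (formal_prod I f) k" if "k \<le> N" for k
        using X(3)[rule_format, of "T - I0" k] T(1) that by simp
    qed
    finally show ?thesis .
  qed
  moreover have "finite (I0 \<union> X)" "I0 \<union> X \<subseteq> I0 \<union> I" using X(1,2) I0(1) by auto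
  ultimately show "\<forall>\<^sub>F T in finite_subsets_at_top (I0 \<union> I).
      fps_nth (\<Prod>i\<in>T. f i) N = fps_nth ((\<Prod>i\<in>I0. f i) * formal_prod I f) N"
    unfolding eventually_finite_subsets_at_top by (intro exI[of _ "I0 \<union> X"] conjI allI impI)
qed

lemma formal_prod_nth_0:
  fixes f :: "'i \<Rightarrow> 'a::comm_ring_1 fps"
  assumes fin: "\<And>N. finite {i \<in> I. \<exists>k\<le>N. fps_nth (f i) k \<noteq> fps_nth 1 k}"
    and one: "\<And>i. i \<in> I \<Longrightarrow> fps_nth (f i) 0 = 1"
  shows "fps_nth (formal_prod I f) 0 = 1"
proof -
  have "\<forall>\<^sub>F T in finite_subsets_at_top I. fps_nth (\<Prod>i\<in>T. f i) 0 = fps_nth (formal_prod I f) 0"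
    using formal_prod_tendsto[OF fin] unfolding tendsto_fps_iff by blast
  then obtain X where X: "finite X" "X \<subseteq> I" "fps_nth (\<Prod>i\<in>X. f i) 0 = fps_nth (formal_prod I f) 0"
    by (rule eventually_finite_subsets_at_topE) blast
  have "fps_nth (\<Prod>i\<in>X. f i) 0 = 1"
    using X(1,2) by (induction X rule: finite_induct) (auto simp: one)
  then show ?thesis using X by simp
qed

section \<open>The discriminant and the series S(q)\<close>

lemma fls_nth_fls_map:
  assumes "h 0 = 0"
  shows "fls_nth (fls_map h f) k = h (fls_nth f k)"
  unfolding fls_map_def using assms
  by (intro nth_Abs_fls_lower_bound[of "fls_subdegree f"]) auto

lemma exact_quot_eqI:
  assumes "h * g = f" "g \<noteq> 0"
  shows "exact_quot f g = h"
  unfolding exact_quot_def using assms by (intro the_equality) auto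

definition discriminant :: "nat \<Rightarrow> (nat \<Rightarrow> nat \<Rightarrow> int) \<Rightarrow> rat group_ring" where
  "discriminant n A = (\<Prod>\<alpha>\<in>fin_roots n A. 1 - Poly_Mapping.single (restr n A \<alpha>) 1)"

context affine_form
begin

lemma fin_weyl_bij:
  assumes "w \<in> fin_weyl n A"
  shows "bij w"
  using assms
proof (induction rule: fin_weyl_induct)
  case id
  then show ?case using bij_id by (simp add: id_def)
next
  case (refl i w)
  have "bij (weight_refl n A i)"
    by (rule involuntory_imp_bij) (use refl diag in \<open>auto intro!: weight_refl_involutive\<close>)
  then show ?case using bij_comp[OF refl(2)] by (simp add: comp_def)
qed

lemma push_fin_weyl_discriminant:
  assumes "w \<in> fin_weyl n A"
  shows "push w (discriminant n A) = discriminant n A"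
  using assms
proof (induction rule: fin_weyl_induct)
  case id
  then show ?case by (simp add: push_id)
next
  case (refl i w)
  let ?s = "weight_refl n A i"
  have s0: "?s 0 = 0" by (simp add: weight_refl_def)
  have i: "i \<le> n" using refl by simp
  have "push ?s (discriminant n A) = (\<Prod>\<alpha>\<in>fin_roots n A. 1 - Poly_Mapping.single (restr n A (root_refl n A i \<alpha>)) 1)"
    using refl(1) s0 by (simp add: discriminant_def push_prod weight_refl_add push_one_minus_exp restr_root_refl)
  also have "\<dots> = discriminant n A"
    unfolding discriminant_def
    by (rule prod.reindex_bij_witness[of _ "root_refl n A i" "root_refl n A i"])
      (use refl(1) i in \<open>auto simp: root_refl_involutive intro: root_refl_fin_roots\<close>)
  finally show ?case using refl(2) push_push[of ?s w "discriminant n A"] by simp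
qed

lemma push_uminus_discriminant: "push uminus (discriminant n A) = discriminant n A"
proof -
  have "push uminus (discriminant n A) = (\<Prod>\<alpha>\<in>fin_roots n A. 1 - Poly_Mapping.single (restr n A (- \<alpha>)) 1)"
    by (simp add: discriminant_def push_prod push_one_minus_exp restr_uminus)
  also have "\<dots> = discriminant n A"
    unfolding discriminant_def
    by (rule prod.reindex_bij_witness[of _ uminus uminus]) (auto simp: uminus_fin_roots)
  finally show ?thesis .
qed

text \<open>
  The finite roots are the positive ones and their negatives, which makes the discriminant the product
  of \<open>D\<close> and its image under inversion of weights. Here \<open>D \<noteq> 0\<close>, because the restriction of a finite
  root is nonzero and the group ring is a domain.
\<close>

lemma const_coeff_discriminant_pos: "Poly_Mapping.lookup (discriminant n A) 0 > 0"
proof -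
  let ?P = "fin_pos_roots n A" and ?f = "\<lambda>\<alpha>. 1 - Poly_Mapping.single (restr n A \<alpha>) (1::rat)"
  have fin: "finite ?P" using finite_fin_roots by (simp add: fin_pos_roots_def)
  have nz: "?f \<alpha> \<noteq> 0" if "\<alpha> \<in> fin_roots n A" for \<alpha>
  proof
    assume "?f \<alpha> = 0"
    then have "Poly_Mapping.lookup (?f \<alpha>) 0 = 0" by simp
    then show False using fin_root_restr_nonzero[OF that]
      by (simp add: lookup_minus lookup_one lookup_single when_def)
  qed
  have "(\<Prod>\<alpha>\<in>?P. ?f \<alpha>) \<noteq> 0"
    using fin nz by (simp add: fin_pos_roots_def)
  then have pos: "Poly_Mapping.lookup ((\<Prod>\<alpha>\<in>?P. ?f \<alpha>) * push uminus (\<Prod>\<alpha>\<in>?P. ?f \<alpha>)) 0 > 0"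
    by (rule const_coeff_mult_push_uminus_pos)
  have union: "fin_roots n A = ?P \<union> uminus ` ?P"
  proof (intro equalityI subsetI)
    fix \<alpha> assume \<alpha>: "\<alpha> \<in> fin_roots n A"
    show "\<alpha> \<in> ?P \<union> uminus ` ?P"
    proof (cases "\<forall>i. Poly_Mapping.lookup \<alpha> i \<ge> 0")
      case False
      then have "\<forall>i. Poly_Mapping.lookup \<alpha> i \<le> 0" using fin_root_sign[OF \<alpha>] by blast
      then have "- \<alpha> \<in> ?P" using uminus_fin_roots[OF \<alpha>] by (simp add: fin_pos_roots_def)
      then show ?thesis by (metis UnI2 image_eqI minus_minus)
    qed (use \<alpha> in \<open>simp add: fin_pos_roots_def\<close>)
  qed (auto simp: fin_pos_roots_def uminus_fin_roots)
  have disj: "?P \<inter> uminus ` ?P = {}"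
  proof (rule ccontr)
    assume "?P \<inter> uminus ` ?P \<noteq> {}"
    then obtain \<alpha> where \<alpha>: "\<alpha> \<in> ?P" "- \<alpha> \<in> ?P" by force
    then have "\<alpha> = 0"
      by (intro poly_mapping_eqI) (simp add: fin_pos_roots_def order_antisym)
    then show False using \<alpha> fin_root_restr_nonzero[of \<alpha>] restr_uminus[of n A 0]
      by (simp add: fin_pos_roots_def restr_def)
  qed
  have "discriminant n A = (\<Prod>\<alpha>\<in>?P. ?f \<alpha>) * (\<Prod>\<alpha>\<in>uminus ` ?P. ?f \<alpha>)"
    unfolding discriminant_def by (subst union) (use fin disj in \<open>simp add: prod.union_disjoint\<close>)
  also have "(\<Prod>\<alpha>\<in>uminus ` ?P. ?f \<alpha>) = push uminus (\<Prod>\<alpha>\<in>?P. ?f \<alpha>)"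
    by (simp add: prod.reindex push_prod push_one_minus_exp restr_uminus)
  finally show ?thesis using pos by simp
qed

text \<open>
  The factors without \<open>X\<close> are exactly those of the finite roots: a finite root is negative or a positive
  real root, and real roots with coefficient \<open>0\<close> at \<open>\<alpha>\<^sub>0\<close> are finite roots.
\<close>

lemma nabla_q_factorization:
  "\<exists>E. fps_nth E 0 = 1 \<and> nabla_q n A = fps_to_fls (fps_const (discriminant n A) * E)"
proof -
  define I where "I = {\<alpha> \<in> pos_real_roots n A. Poly_Mapping.lookup \<alpha> 0 > 0}"
  let ?f = "\<lambda>\<alpha>. 1 - exp_root n A \<alpha>"
  have nth: "fps_nth (?f \<alpha>) k = fps_nth 1 k" if "k \<noteq> nat (Poly_Mapping.lookup \<alpha> 0)" for \<alpha> k
    using that by (simp add: exp_root_def)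
  have fin: "finite {\<alpha> \<in> I. \<exists>k\<le>N. fps_nth (?f \<alpha>) k \<noteq> fps_nth 1 k}" for N
  proof (rule finite_subset)
    show "{\<alpha> \<in> I. \<exists>k\<le>N. fps_nth (?f \<alpha>) k \<noteq> fps_nth 1 k} \<subseteq>
        (\<Union>k\<le>N. {\<alpha> \<in> real_roots n A. Poly_Mapping.lookup \<alpha> 0 = int k})"
    proof
      fix \<alpha> assume "\<alpha> \<in> {\<alpha> \<in> I. \<exists>k\<le>N. fps_nth (?f \<alpha>) k \<noteq> fps_nth 1 k}"
      then obtain k where "\<alpha> \<in> I" "k \<le> N" "fps_nth (?f \<alpha>) k \<noteq> fps_nth 1 k" by blast
      moreover from this have "k = nat (Poly_Mapping.lookup \<alpha> 0)" using nth by blast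
      ultimately show "\<alpha> \<in> (\<Union>k\<le>N. {\<alpha> \<in> real_roots n A. Poly_Mapping.lookup \<alpha> 0 = int k})"
        by (intro UN_I[of k]) (auto simp: I_def pos_real_roots_def)
    qed
  qed (intro finite_UN_I finite_real_roots_degree, simp)
  have index: "fin_neg_roots n A \<union> pos_real_roots n A = fin_roots n A \<union> I"
  proof (intro equalityI subsetI)
    fix \<alpha> assume "\<alpha> \<in> fin_neg_roots n A \<union> pos_real_roots n A"
    then show "\<alpha> \<in> fin_roots n A \<union> I"
      unfolding I_def fin_roots_eq[symmetric] fin_neg_roots_def
      by (auto simp: pos_real_roots_def fin_roots_eq order.order_iff_strict)
  next
    fix \<alpha> assume "\<alpha> \<in> fin_roots n A \<union> I"
    then show "\<alpha> \<in> fin_neg_roots n A \<union> pos_real_roots n A"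
    proof
      assume \<alpha>: "\<alpha> \<in> fin_roots n A"
      then have "\<alpha> \<in> real_roots n A" using fin_roots_subset_real_roots by blast
      then show ?thesis using fin_root_sign[OF \<alpha>] \<alpha>
        unfolding fin_neg_roots_def pos_real_roots_def by blast
    qed (simp add: I_def)
  qed
  have disj: "fin_roots n A \<inter> I = {}" using lookup_fin_roots_0 by (fastforce simp: I_def)
  have "(\<Prod>\<alpha>\<in>fin_roots n A. ?f \<alpha>) = (\<Prod>\<alpha>\<in>fin_roots n A. fps_const (1 - Poly_Mapping.single (restr n A \<alpha>) 1))"
    by (intro prod.cong refl) (simp add: exp_root_def lookup_fin_roots_0 flip: fps_const_sub)
  also have "\<dots> = fps_const (discriminant n A)"
    unfolding discriminant_def by (induction rule: infinite_finite_induct) (auto simp flip: fps_const_mult)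
  finally have "formal_prod (fin_neg_roots n A \<union> pos_real_roots n A) ?f = fps_const (discriminant n A) * formal_prod I ?f"
    using formal_prod_split_finite[of I ?f, OF fin finite_fin_roots disj] by (simp add: index)
  moreover have "fps_nth (formal_prod I ?f) 0 = 1"
    by (rule formal_prod_nth_0[OF fin]) (simp add: exp_root_def I_def)
  ultimately show ?thesis unfolding nabla_q_def by (intro exI[of _ "formal_prod I ?f"]) simp
qed

text \<open>
  Up to the scalar series \<open>G\<close> from normalization and the order of the Weyl group, \<open>S(q)\<close> is the factor \<open>E\<close>
  of \<open>\<nabla>(q, \<infinity>)\<close>. Its lowest coefficient is a nonzero rational number, so it is invertible.
\<close>

lemma S_q_unit:
  "\<exists>S' SF. S_q n A = fps_to_fls SF \<and> fps_to_fls SF * S' = 1 \<and> fps_to_fls SF * Delta_infinity n A = Delta_q n A"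
proof -
  obtain E where E0: "fps_nth E 0 = 1" and nabla: "nabla_q n A = fps_to_fls (fps_const (discriminant n A) * E)"
    using nabla_q_factorization by blast
  define D where "D = discriminant n A"
  define W :: rat where "W = of_nat (card (fin_weyl n A))"
  have W: "W \<noteq> 0" using finite_fin_weyl longest_in_fin_weyl by (auto simp: W_def)
  have D0: "Poly_Mapping.lookup D 0 \<noteq> 0" using const_coeff_discriminant_pos by (simp add: D_def)
  define c where "c = Abs_fps (\<lambda>k. Poly_Mapping.lookup (fps_nth (fps_const D * E) k) 0)"
  have c: "const_term (nabla_q n A) = fps_to_fls c"
    by (rule fls_eqI) (simp add: const_term_def fls_nth_fls_map nabla c_def D_def)
  have c0: "fps_nth c 0 = Poly_Mapping.lookup D 0" by (simp add: c_def E0)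
  then have "inverse (const_term (nabla_q n A)) = fps_to_fls (inverse c)"
    unfolding c using D0 by (intro fls_inverse_fps_to_fls) (simp add: subdegree_eq_0)
  moreover define G where "G = Abs_fps (\<lambda>k. Poly_Mapping.single (0::weight) (fps_nth (inverse c) k))"
  ultimately have G: "series_of_scalar (inverse (const_term (nabla_q n A))) = fps_to_fls G"
    by (intro fls_eqI) (simp add: series_of_scalar_def fls_nth_fls_map)
  have Dq: "Delta_q n A = fps_to_fls (G * (fps_const D * E))"
    unfolding Delta_q_def G by (simp add: nabla D_def fls_times_fps_to_fls)
  have Dinf: "Delta_infinity n A = fps_to_fls (fps_const (Poly_Mapping.single 0 (1 / W) * D))"
    unfolding Delta_infinity_def D_def discriminant_def W_def by simp
  define SF where "SF = fps_const (Poly_Mapping.single 0 W) * G * E"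
  have one: "Poly_Mapping.single 0 W * Poly_Mapping.single (0::weight) (1 / W) = 1"
    using W by (simp add: mult_single)
  have "SF * fps_const (Poly_Mapping.single 0 (1 / W) * D) =
      fps_const (Poly_Mapping.single 0 W * Poly_Mapping.single 0 (1 / W)) * (G * (fps_const D * E))"
    by (simp only: SF_def mult_ac flip: fps_const_mult)
  then have "SF * fps_const (Poly_Mapping.single 0 (1 / W) * D) = G * (fps_const D * E)"
    unfolding one by simp
  then have eq: "fps_to_fls SF * Delta_infinity n A = Delta_q n A"
    unfolding Dq Dinf by (simp only: fls_times_fps_to_fls[symmetric])
  have "Poly_Mapping.single 0 (1 / W) * D \<noteq> 0"
  proof
    assume "Poly_Mapping.single 0 (1 / W) * D = 0"
    then have "Poly_Mapping.single 0 W * (Poly_Mapping.single 0 (1 / W) * D) = 0" by simp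
    then have "D = 0" by (simp only: mult.assoc[symmetric] one) simp
    then show False using D0 by simp
  qed
  then have "S_q n A = fps_to_fls SF"
    unfolding S_q_def using eq by (intro exact_quot_eqI) (simp_all add: Dinf)
  moreover have "fps_nth SF 0 * Poly_Mapping.single 0 (fps_nth c 0 / W) = 1"
    using W D0 by (simp add: SF_def G_def E0 c0 mult_single)
  then have "SF * fps_right_inverse SF (Poly_Mapping.single 0 (fps_nth c 0 / W)) = 1"
    by (rule fps_right_inverse)
  then have "fps_to_fls SF * fps_to_fls (fps_right_inverse SF (Poly_Mapping.single 0 (fps_nth c 0 / W))) = 1"
    by (simp flip: fls_times_fps_to_fls)
  ultimately show ?thesis using eq by blast
qed

lemma exact_quot_S_q_mult_Delta_q:
  "exact_quot f (S_q n A) * Delta_q n A = f * Delta_infinity n A"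
proof -
  obtain S' SF where S: "S_q n A = fps_to_fls SF" "fps_to_fls SF * S' = 1"
      "fps_to_fls SF * Delta_infinity n A = Delta_q n A" using S_q_unit by blast
  have "f * S' * S_q n A = f" using S(2) by (simp add: S(1) mult_ac)
  moreover have "S_q n A \<noteq> 0" using S(2) by (auto simp: S(1))
  ultimately have "exact_quot f (S_q n A) = f * S'" by (rule exact_quot_eqI)
  then show ?thesis using S(2) by (simp flip: S(3)) (simp add: mult_ac)
qed

lemma push_fin_weyl_invariant:
  assumes "w \<in> fin_weyl n A" and "\<And>\<nu>. Poly_Mapping.lookup p (w \<nu>) = Poly_Mapping.lookup p \<nu>"
  shows "push w p = p"
proof (rule poly_mapping_eqI)
  fix k
  have w: "bij w" using assms(1) by (rule fin_weyl_bij)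
  then obtain \<nu> where "k = w \<nu>" by (metis bij_pointE)
  then show "Poly_Mapping.lookup (push w p) k = Poly_Mapping.lookup p k"
    using w assms(2) by (simp add: lookup_push_inj bij_is_inj)
qed

text \<open>
  With \<open>w\<close> the longest element this is the exchange of \<open>\<iota>\<close> between the two arguments of the scalar
  product. Since \<open>p\<close> is invariant, \<open>\<iota>\<close> acts on it as inversion of weights, and applying \<open>\<iota>\<close> once more to the
  product undoes this inversion.
\<close>

lemma const_coeff_adjoint:
  fixes p chi :: "rat group_ring"
  assumes w: "w \<in> fin_weyl n A" and p: "push w p = p"
  shows "Poly_Mapping.lookup (chi * push (\<lambda>\<nu>. - w \<nu>) p * discriminant n A) 0 =
    Poly_Mapping.lookup (p * push (\<lambda>\<nu>. - w \<nu>) chi * discriminant n A) 0"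
proof -
  let ?\<phi> = "\<lambda>\<nu>. - w \<nu>"
  have add: "?\<phi> (lam + \<nu>) = ?\<phi> lam + ?\<phi> \<nu>" for lam \<nu> using fin_weyl_add[OF w] by simp
  have w0: "w 0 = 0" using fin_weyl_add[OF w, of 0 0] by simp
  have inj: "inj ?\<phi>" using bij_is_inj[OF fin_weyl_bij[OF w]] by (auto simp: inj_def)
  have neg: "w (- \<nu>) = - w \<nu>" for \<nu>
    using fin_weyl_add[OF w, of "- \<nu>" \<nu>] w0 by (simp add: eq_neg_iff_add_eq_0)
  have \<phi>: "push ?\<phi> f = push uminus (push w f)" for f :: "rat group_ring" by (simp add: push_push)
  have "push ?\<phi> (push uminus p) = p" using p by (simp add: push_push neg)
  moreover have "push ?\<phi> (discriminant n A) = discriminant n A"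
    unfolding \<phi> by (simp add: push_fin_weyl_discriminant[OF w] push_uminus_discriminant)
  ultimately have "push ?\<phi> (chi * push uminus p * discriminant n A) = p * push ?\<phi> chi * discriminant n A"
    by (simp add: push_mult[of ?\<phi>, OF add] mult_ac)
  moreover have "push ?\<phi> p = push uminus p" unfolding \<phi> by (simp add: p)
  ultimately show ?thesis
    using lookup_push_inj[OF inj, of "chi * push uminus p * discriminant n A" 0] w0 by simp
qed

end

section \<open>The limit scalar products\<close>

text \<open>
  The limit is the ratio of two coefficients in a fixed degree; cross-multiplying two representations
  of \<open>f\<close> and comparing top coefficients shows that the ratio is the same for both.
\<close>

lemma ratfun_lim_infinity_unique:
  assumes "ratfun_lim_infinity f c" "ratfun_lim_infinity f c'"
  shows "c = c'"
proof -
  obtain p r where p: "r \<noteq> 0" "f = Fraction_Field.Fract p r" "Polynomial.degree p \<le> Polynomial.degree r"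
      "c = Polynomial.coeff p (Polynomial.degree r) / lead_coeff r"
    using assms(1) by (auto simp: ratfun_lim_infinity_def)
  obtain p' r' where p': "r' \<noteq> 0" "f = Fraction_Field.Fract p' r'" "Polynomial.degree p' \<le> Polynomial.degree r'"
      "c' = Polynomial.coeff p' (Polynomial.degree r') / lead_coeff r'"
    using assms(2) by (auto simp: ratfun_lim_infinity_def)
  have top: "Polynomial.coeff (a * b) (k + Polynomial.degree b) = Polynomial.coeff a k * lead_coeff b"
    if "Polynomial.degree a \<le> k" for a b :: "'a poly" and k
  proof (cases "Polynomial.degree a = k")
    case True
    then show ?thesis using coeff_mult_degree_sum[of a b] by simp
  next
    case False
    then have "Polynomial.degree (a * b) < k + Polynomial.degree b"
      using that degree_mult_le[of a b] by linarith
    then show ?thesis using False that by (simp add: coeff_eq_0)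
  qed
  have eq: "p * r' = p' * r" using p p' by (simp add: eq_fract)
  have "Polynomial.coeff p (Polynomial.degree r) * lead_coeff r' =
      Polynomial.coeff (p * r') (Polynomial.degree r + Polynomial.degree r')"
    using top[OF p(3), of r'] by simp
  also have "\<dots> = Polynomial.coeff (p' * r) (Polynomial.degree r' + Polynomial.degree r)"
    by (simp add: eq add.commute)
  also have "\<dots> = Polynomial.coeff p' (Polynomial.degree r') * lead_coeff r"
    using top[OF p'(3), of r] by simp
  finally show ?thesis using p p' by (simp add: frac_eq_eq)
qed

lemma iota_nth: "fls_nth (iota n A f) k = push (\<lambda>\<nu>. - longest n A \<nu>) (fls_nth f k)"
  unfolding iota_def by (subst fls_nth_fls_map) (simp_all add: push_def)

lemma lookup_series_of:
  "Poly_Mapping.lookup (fls_nth (series_of f) k) \<nu> =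
    (if \<nu> \<in> Poly_Mapping.keys f then fls_nth (expand_q (Poly_Mapping.lookup f \<nu>)) k else 0)"
  by (auto simp: series_of_def fls_nth_sum fls_nth_fls_map lookup_sum lookup_single when_def cong: if_cong)

text \<open>
  Limits are unique, so invariance passes from \<open>f\<close> to \<open>p\<close>. Outside the weight lattice both coefficients
  vanish, because the Weyl group preserves the lattice and its complement.
\<close>

lemma limit_invariant:
  assumes f: "f \<in> invariants n A" and lim: "is_limit_t f p" and w: "w \<in> fin_weyl n A"
  shows "Poly_Mapping.lookup p (w \<nu>) = Poly_Mapping.lookup p \<nu>"
proof -
  have keys: "Poly_Mapping.keys f \<subseteq> weights n"
    and inv: "\<nu> \<in> weights n \<Longrightarrow> Poly_Mapping.lookup f (w \<nu>) = Poly_Mapping.lookup f \<nu>"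
    using f w by (auto simp: invariants_def)
  have "Poly_Mapping.lookup f (w \<nu>) = Poly_Mapping.lookup f \<nu>"
  proof (cases "\<nu> \<in> weights n")
    case False
    then have "w \<nu> \<notin> weights n" using fin_weyl_in_weights_iff[OF w] by blast
    then have "w \<nu> \<notin> Poly_Mapping.keys f" "\<nu> \<notin> Poly_Mapping.keys f" using False keys by blast+
    then show ?thesis by (simp add: in_keys_iff)
  qed (rule inv)
  then show ?thesis
    using lim ratfun_lim_infinity_unique unfolding is_limit_t_def by metis
qed

theorem proposition3p4:
  fixes n :: nat and A :: "nat \<Rightarrow> nat \<Rightarrow> int" and lam \<mu> :: weight
    and P :: "weight \<Rightarrow> Fqt group_ring" and Pq_\<mu> :: "Fq group_ring"
  assumes "affine_datum n A"
    and "macdonald_family n A P"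
    and "lam \<in> antidominant n"
    and "\<mu> \<in> antidominant n"
    and "is_limit_t (P \<mu>) Pq_\<mu>"
  shows "scalar_q n A (exact_quot (fls_const (irr_char n A lam)) (S_q n A)) (series_of Pq_\<mu>) =
         scalar_infinity n A (series_of Pq_\<mu>) (fls_const (irr_char n A lam))"
proof -
  have "affine_cartan_matrix n A" using assms(1) by (simp add: affine_datum_def)
  then obtain d u where "affine_form n A d u" using affine_form_exists by blast
  then interpret affine_form n A d u .
  let ?w = "longest n A" and ?chi = "irr_char n A lam" and ?f = "series_of Pq_\<mu>"
  let ?c = "Poly_Mapping.single 0 (1 / of_nat (card (fin_weyl n A))) :: rat group_ring"
  have Dinf: "Delta_infinity n A = fls_const (?c * discriminant n A)"
    by (simp add: Delta_infinity_def discriminant_def)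
  have w: "?w \<in> fin_weyl n A" by (rule longest_in_fin_weyl)
  have "P \<mu> \<in> invariants n A" using assms(2,4) unfolding macdonald_family_def by blast
  then have inv: "push ?w (fls_nth ?f k) = fls_nth ?f k" for k
    using w limit_invariant[OF _ assms(5) w] by (intro push_fin_weyl_invariant) (simp_all add: lookup_series_of in_keys_iff)
  have "fls_nth (scalar_q n A (exact_quot (fls_const ?chi) (S_q n A)) ?f) k =
      fls_nth (scalar_infinity n A ?f (fls_const ?chi)) k" for k
  proof -
    have "exact_quot (fls_const ?chi) (S_q n A) * iota n A ?f * Delta_q n A =
        fls_const ?chi * iota n A ?f * Delta_infinity n A"
      using exact_quot_S_q_mult_Delta_q[of "fls_const ?chi"] by (simp add: mult_ac)
    also have "fls_nth \<dots> k = ?c * (?chi * push (\<lambda>\<nu>. - ?w \<nu>) (fls_nth ?f k) * discriminant n A)"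
      unfolding Dinf by (simp add: iota_nth mult_ac)
    finally have 1: "fls_nth (exact_quot (fls_const ?chi) (S_q n A) * iota n A ?f * Delta_q n A) k =
        ?c * (?chi * push (\<lambda>\<nu>. - ?w \<nu>) (fls_nth ?f k) * discriminant n A)" .
    have "iota n A (fls_const ?chi) = fls_const (push (\<lambda>\<nu>. - ?w \<nu>) ?chi)"
      by (rule fls_eqI) (simp add: iota_nth)
    then have 2: "fls_nth (?f * iota n A (fls_const ?chi) * Delta_infinity n A) k =
        ?c * (fls_nth ?f k * push (\<lambda>\<nu>. - ?w \<nu>) ?chi * discriminant n A)"
      unfolding Dinf by (simp add: mult_ac)
    show ?thesis
      unfolding scalar_q_def scalar_infinity_def const_term_def
      by (simp add: fls_nth_fls_map 1 2 lookup_single_0_mult const_coeff_adjoint[OF w inv])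
  qed
  then show ?thesis by (intro fls_eqI)
qed

end
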